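(* Let $\mu$ be a probability measure on $E$ and $\psi:E\to\mathbb{R}^n$ a diffeomorphism. If $\psi_*\mu=\gamma$ is the standard Gaussian measure on $\mathbb{R}^n$, then $\mu$ satisfies the $\psi$-$T_2$ inequality $$W_2^\psi(\nu,\mu)\le\sqrt{2D(\nu\|\mu)}$$ for all probability measures $\nu\ll\mu$ on $E$, where $D(\nu\|\mu)$ is the relative entropy.
   Context: The pushforward is $(\psi_*\mu)(B)=\mu(\psi^{-1}(B))$. A diffeomorphism is in particular a measurable bijection with measurable inverse. The $\psi$-Wasserstein distance of order $p$ between probability measures $\mu,\nu$ on $E$ is $$W_p^\psi(\mu,\nu):=W_p(\psi_*\mu,\psi_*\nu)=\left(\inf_{\pi\in\Pi(\mu,\nu)}\int\|\psi(x)-\psi(y)\|^p\,d\pi(x,y)\right)^{1/p},$$ where $\Pi(\mu,\nu)$ is the set of couplings of $\mu$ and $\nu$ and $W_p$ is the usual Wasserstein distance on $\mathbb{R}^n$ for the Euclidean norm. The relative entropy is $D(\nu\|\mu)=\int\log\frac{d\nu}{d\mu}\,d\nu\in[0,\infty]$. *)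

theory Defs
  imports "HOL-Probability.Probability" "HOL-Library.Extended_Nat"
begin

text \<open>
  \<open>C\<^sup>k\<close> functions on an open set \<open>S\<close> of a Euclidean space. All directional derivatives are
  again of class \<open>C\<^sup>j\<close>; as the domain is finite-dimensional this is the same as the
  derivative being \<open>C\<^sup>j\<close> as an operator-valued function. \<open>k = \<infinity>\<close> means smooth.
\<close>

primrec differentiable_class ::
  "nat \<Rightarrow> 'a::euclidean_space set \<Rightarrow> ('a \<Rightarrow> 'b::euclidean_space) \<Rightarrow> bool"
where
  "differentiable_class 0 S = (\<lambda>f. continuous_on S f)"
| "differentiable_class (Suc j) S = (\<lambda>f. f differentiable_on S \<and>
     (\<forall>v. differentiable_class j S (\<lambda>x. frechet_derivative f (at x) v)))"

definition Ck_on ::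
  "enat \<Rightarrow> 'a::euclidean_space set \<Rightarrow> ('a \<Rightarrow> 'b::euclidean_space) \<Rightarrow> bool"
where
  "Ck_on k S f \<longleftrightarrow> (\<forall>j. enat j \<le> k \<longrightarrow> differentiable_class j S f)"

text \<open>
  A chart of a topological space is a pair \<open>(U, \<phi>)\<close>; values of \<open>\<phi>\<close> outside \<open>U\<close> are irrelevant,
  and the inverse of the chart is \<open>inv_into U \<phi>\<close>. Atlases need not be maximal: the differentiable
  structure is the one generated by the atlas.
\<close>

definition is_chart :: "'e topology \<Rightarrow> 'e set \<times> ('e \<Rightarrow> 'a::euclidean_space) \<Rightarrow> bool" where
  "is_chart E = (\<lambda>(U, \<phi>). openin E U \<and> open (\<phi> ` U) \<and>
     homeomorphic_map (subtopology E U) (top_of_set (\<phi> ` U)) \<phi>)"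

definition Ck_manifold ::
  "enat \<Rightarrow> 'e topology \<Rightarrow> ('e set \<times> ('e \<Rightarrow> 'a::euclidean_space)) set \<Rightarrow> bool"
where
  "Ck_manifold k E A \<longleftrightarrow>
     Hausdorff_space E \<and> second_countable E \<and>
     (\<forall>c\<in>A. is_chart E c) \<and> (\<Union>(U, \<phi>)\<in>A. U) = topspace E \<and>
     (\<forall>(U, \<phi>)\<in>A. \<forall>(V, \<eta>)\<in>A. Ck_on k (\<phi> ` (U \<inter> V)) (\<eta> \<circ> inv_into U \<phi>))"

definition Ck_map ::
  "enat \<Rightarrow> 'e topology \<Rightarrow> ('e set \<times> ('e \<Rightarrow> 'a::euclidean_space)) set \<Rightarrow>
   'f topology \<Rightarrow> ('f set \<times> ('f \<Rightarrow> 'b::euclidean_space)) set \<Rightarrow> ('e \<Rightarrow> 'f) \<Rightarrow> bool"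
where
  "Ck_map k E A F B f \<longleftrightarrow> continuous_map E F f \<and>
     (\<forall>(U, \<phi>)\<in>A. \<forall>(V, \<eta>)\<in>B. Ck_on k (\<phi> ` (U \<inter> f -` V)) (\<eta> \<circ> f \<circ> inv_into U \<phi>))"

definition Ck_diffeomorphism ::
  "enat \<Rightarrow> 'e topology \<Rightarrow> ('e set \<times> ('e \<Rightarrow> 'a::euclidean_space)) set \<Rightarrow>
   'f topology \<Rightarrow> ('f set \<times> ('f \<Rightarrow> 'b::euclidean_space)) set \<Rightarrow> ('e \<Rightarrow> 'f) \<Rightarrow> bool"
where
  "Ck_diffeomorphism k E A F B f \<longleftrightarrow>
     bij_betw f (topspace E) (topspace F) \<and>
     Ck_map k E A F B f \<and> Ck_map k F B E A (inv_into (topspace E) f)"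

definition standard_atlas :: "('a::euclidean_space set \<times> ('a \<Rightarrow> 'a)) set" where
  "standard_atlas = {(UNIV, id)}"

definition borel_of :: "'e topology \<Rightarrow> 'e measure" where
  "borel_of E = sigma (topspace E) {U. openin E U}"

definition standard_gaussian :: "'a::euclidean_space measure" where
  "standard_gaussian =
     density lborel (\<lambda>x. ennreal (exp (- (norm x)\<^sup>2 / 2) / (2 * pi) powr (real DIM('a) / 2)))"

text \<open>Powers of extended nonnegative reals, meant for exponents \<open>a > 0\<close>.\<close>

definition ennreal_powr :: "ennreal \<Rightarrow> real \<Rightarrow> ennreal" where
  "ennreal_powr x a = (if x = \<top> then \<top> else ennreal (enn2real x powr a))"

definition couplings :: "'a measure \<Rightarrow> 'b measure \<Rightarrow> ('a \<times> 'b) measure set" where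
  "couplings M N = {\<pi>. sets \<pi> = sets (M \<Otimes>\<^sub>M N) \<and> distr \<pi> M fst = M \<and> distr \<pi> N snd = N}"

text \<open>The order \<open>p\<close> is meant to satisfy \<open>p \<ge> 1\<close>. The distance may be infinite.\<close>

definition wasserstein ::
  "real \<Rightarrow> 'a::euclidean_space measure \<Rightarrow> 'a measure \<Rightarrow> ennreal"
where
  "wasserstein p M N = ennreal_powr
     (INF \<pi>\<in>couplings M N. \<integral>\<^sup>+ (x, y). ennreal (norm (x - y) powr p) \<partial>\<pi>) (1 / p)"

definition psi_wasserstein ::
  "real \<Rightarrow> ('e \<Rightarrow> 'a::euclidean_space) \<Rightarrow> 'e measure \<Rightarrow> 'e measure \<Rightarrow> ennreal"
where
  "psi_wasserstein p \<psi> M N = wasserstein p (distr M borel \<psi>) (distr N borel \<psi>)"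

text \<open>
  The relative entropy \<open>D(\<nu>\<parallel>\<mu>)\<close>; note that \<open>KL_divergence\<close> takes its arguments in the opposite
  order. For probability measures \<open>\<nu> \<lless> \<mu>\<close> the negative part of \<open>log (d\<nu>/d\<mu>)\<close> is always
  \<open>\<nu>\<close>-integrable (since \<open>t log t \<ge> -1/e\<close>), so if \<open>log (d\<nu>/d\<mu>)\<close> is not \<open>\<nu>\<close>-integrable then its integral
  is \<open>+\<infinity>\<close>, whereas the Bochner integral in \<open>KL_divergence\<close> would be \<open>0\<close>.
\<close>

definition relative_entropy :: "'e measure \<Rightarrow> 'e measure \<Rightarrow> ennreal" where
  "relative_entropy \<nu> \<mu> =
     (if absolutely_continuous \<mu> \<nu> \<and> integrable \<nu> (entropy_density (exp 1) \<mu> \<nu>)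
      then ennreal (KL_divergence (exp 1) \<mu> \<nu>) else \<top>)"

end

theory Submission
  imports Defs "HOL-Real_Asymp.Real_Asymp"
begin

text \<open>
  This is Talagrand's transport inequality for the Gaussian measure \<open>\<gamma>\<close>, carried over to \<open>E\<close> by \<open>\<psi>\<close>.

  On the line, let \<open>S\<close> be the increasing map taking \<open>\<nu> = f \<gamma>\<close> to \<open>\<gamma>\<close>, so that \<open>\<phi>(S) S' = f \<phi>\<close> for
  the Gaussian density \<open>\<phi>\<close>. Then \<open>2 ln f - (x - S)\<^sup>2 = 2 (ln S' - S (S - x))\<close>, and
  \<open>ln S' \<ge> 1 - 1 / S'\<close>, whose \<open>\<nu>\<close>-integral is that of \<open>S (S - x)\<close> by integration by parts. This
  settles sufficiently regular densities; arbitrary ones follow by approximation, since the maps \<open>S\<close>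
  converge pointwise and Fatou's lemma applies to the cost. In higher dimensions the inequality
  tensorizes along the triangular (Knothe) map, because entropy obeys the chain rule and the squared
  distance is additive over coordinates.
\<close>

subsection \<open>Monotone rearrangement on an interval\<close>

text \<open>The map runs from \<nu> to \<gamma> and not the other way: the quantile function
  involved is then that of \<gamma>, continuous on the open unit interval, whereas quantiles of
  \<nu> may jump. Pointwise limits of distribution functions thus become pointwise limits of maps.
  The logarithm of \<open>\<phi>(S) S' = f \<phi>\<close> reads
  \<open>2 ln f = 2 ln S' + x*x - S*S\<close>; the factor 2 of the theorem is the one that clears
  the 1/2 in the Gaussian exponent. Subtracting the squared distance leaves, once
  \<open>ln S'\<close> is bounded below, twice the exact derivative of
  \<open>(S - x) \<phi>(S)\<close>, up to the weight \<open>f \<phi>\<close>. The limit is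
  one-sided. Fatou's lemma controls the cost, but the entropies have to converge, and this shapes
  the approximation: between positive bounds \<open>f ln f\<close> is bounded, so rough densities
  are reached by continuous ones; unbounded or vanishing densities are then truncated from both
  sides, with \<open>\<bar>f ln f\<bar> + 1\<close> as dominating function. A density of infinite
  entropy leaves nothing to prove, so \<open>f ln f\<close> is integrable from there on.\<close>

abbreviation std_normal :: "real measure" where
  "std_normal \<equiv> density lborel std_normal_density"

definition std_normal_cdf :: "real \<Rightarrow> real" where
  "std_normal_cdf = cdf std_normal"

text \<open>The value \<open>0\<close> outside the open unit interval is junk.\<close>

definition quantile :: "real \<Rightarrow> real" where
  "quantile u = (if 0 < u \<and> u < 1 then inv std_normal_cdf u else 0)"

text \<open>For a probability density \<open>f\<close> this is the increasing rearrangement onto the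
  Gaussian: the distribution function of \<open>f\<close>, followed by the normal quantile.\<close>

definition transport_map :: "(real \<Rightarrow> real) \<Rightarrow> real \<Rightarrow> real" where
  "transport_map f x = quantile (\<integral>y. f y * indicator {..x} y \<partial>std_normal)"

text \<open>The cost may a priori be infinite, hence the nonnegative integral. The entropy is a
  Bochner integral, meaningful when \<open>f x * ln (f x)\<close> is integrable.\<close>

definition transport_ineq :: "(real \<Rightarrow> real) \<Rightarrow> bool" where
  "transport_ineq f \<longleftrightarrow>
     (\<integral>\<^sup>+x. ennreal (f x * (x - transport_map f x)\<^sup>2) \<partial>std_normal)
       \<le> ennreal (2 * (\<integral>x. f x * ln (f x) \<partial>std_normal))"

section \<open>The normal distribution function and its inverse\<close>

interpretation std_normal: real_distribution std_normal
  by (rule real_dist_normal_dist)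

lemma std_normal_cdf_eq: "std_normal_cdf x = (\<integral>y. indicator {..x} y \<partial>std_normal)"
  by (simp add: std_normal_cdf_def cdf_def)

lemma continuous_on_std_normal_density: "continuous_on S std_normal_density"
  unfolding normal_density_def by (intro continuous_intros) auto

text \<open>Calculus on an interval uses the gauge integral, limit theorems use the Lebesgue
  integral; this is the exchange between the two.\<close>

lemma
  fixes h :: "real \<Rightarrow> real"
  assumes cont: "continuous_on {a..b} h"
  shows integrable_std_normal_Icc: "integrable std_normal (\<lambda>x. h x * indicator {a..b} x)"
    and integral_std_normal_Icc: "(\<integral>x. h x * indicator {a..b} x \<partial>std_normal) =
      integral {a..b} (\<lambda>x. h x * std_normal_density x)"
proof -
  have meas: "(\<lambda>x. h x * indicator {a..b} x) \<in> borel_measurable borel"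
    using borel_measurable_continuous_on_indicator[OF _ cont] by (simp add: mult.commute)
  have "set_integrable lborel {a..b} (\<lambda>x. h x * std_normal_density x)"
    by (intro borel_integrable_atLeastAtMost' continuous_intros cont continuous_on_std_normal_density)
  then show "integrable std_normal (\<lambda>x. h x * indicator {a..b} x)"
    using meas by (subst integrable_density) (auto simp: set_integrable_def mult_ac)
  have "(\<integral>x. h x * indicator {a..b} x \<partial>std_normal) = (LINT x:{a..b}|lborel. h x * std_normal_density x)"
    using meas unfolding set_lebesgue_integral_def
    by (subst integral_density) (auto simp: mult_ac)
  also have "\<dots> = integral {a..b} (\<lambda>x. h x * std_normal_density x)"
    by (intro set_borel_integral_eq_integral(2)) fact
  finally show "(\<integral>x. h x * indicator {a..b} x \<partial>std_normal) =
      integral {a..b} (\<lambda>x. h x * std_normal_density x)" .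
qed

lemma integral_indicator_atMost_split:
  fixes f :: "real \<Rightarrow> real"
  assumes f: "integrable std_normal f" and "a \<le> x" and cont: "continuous_on {a..x} f"
  shows "(\<integral>y. f y * indicator {..x} y \<partial>std_normal) =
    (\<integral>y. f y * indicator {..a} y \<partial>std_normal) + integral {a..x} (\<lambda>y. f y * std_normal_density y)"
proof -
  have fm[measurable]: "f \<in> borel_measurable borel"
    using borel_measurable_integrable[OF f] by simp
  have int: "integrable std_normal (\<lambda>y. f y * indicator A y)" if "A \<in> sets borel" for A
    using integrable_mult_indicator[OF _ f, of A] that by (simp add: mult.commute)
  \<comment> \<open>The sets \<open>{..a}\<close> and \<open>{a..x}\<close> share the point
    \<open>a\<close>, so the indicators add up only almost everywhere.\<close>
  have "AE y in lborel. y \<noteq> a"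
    by (rule AE_lborel_singleton)
  then have ae: "AE y in std_normal. f y * indicator {..x} y = f y * indicator {..a} y + f y * indicator {a..x} y"
    using \<open>a \<le> x\<close> by (subst AE_density) (auto simp: indicator_def elim!: eventually_mono)
  have "(\<integral>y. f y * indicator {..x} y \<partial>std_normal) =
     (\<integral>y. f y * indicator {..a} y + f y * indicator {a..x} y \<partial>std_normal)"
    by (rule integral_cong_AE[OF _ _ ae]) auto
  also have "\<dots> = (\<integral>y. f y * indicator {..a} y \<partial>std_normal) + (\<integral>y. f y * indicator {a..x} y \<partial>std_normal)"
    by (intro Bochner_Integration.integral_add int) auto
  also have "(\<integral>y. f y * indicator {a..x} y \<partial>std_normal) = integral {a..x} (\<lambda>y. f y * std_normal_density y)"
    by (rule integral_std_normal_Icc[OF cont])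
  finally show ?thesis .
qed

text \<open>Splitting off the constant mass of \<open>{..a}\<close> leaves an integral over a
  compact interval. The derivative is taken within \<open>{a..b}\<close> because the patched
  densities below may jump at the endpoints.\<close>

lemma DERIV_indicator_atMost_integral:
  fixes f :: "real \<Rightarrow> real"
  assumes f: "integrable std_normal f" and cont: "continuous_on {a..b} f" and x: "x \<in> {a..b}"
  shows "((\<lambda>x. \<integral>y. f y * indicator {..x} y \<partial>std_normal) has_real_derivative f x * std_normal_density x)
    (at x within {a..b})"
proof -
  have "((\<lambda>x. (\<integral>y. f y * indicator {..a} y \<partial>std_normal) + integral {a..x} (\<lambda>y. f y * std_normal_density y))
      has_real_derivative 0 + f x * std_normal_density x) (at x within {a..b})"
    by (intro DERIV_add DERIV_const integral_has_real_derivative continuous_intros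
        continuous_on_std_normal_density cont x)
  then show ?thesis
    using x
    by (subst has_field_derivative_cong_eventually)
       (auto simp: eventually_at_filter intro!: always_eventually integral_indicator_atMost_split f
         continuous_on_subset[OF cont])
qed

lemma DERIV_std_normal_cdf: "(std_normal_cdf has_real_derivative std_normal_density x) (at x)"
proof -
  have "(std_normal_cdf has_real_derivative 1 * std_normal_density x) (at x within {x - 1..x + 1})"
    using DERIV_indicator_atMost_integral[of "\<lambda>_. 1" "x - 1" "x + 1" x]
    by (simp add: std_normal_cdf_eq[abs_def])
  moreover have "at x within {x - 1..x + 1} = at x"
    by (rule at_within_interior) simp
  ultimately show ?thesis by simp
qed

lemma strict_mono_std_normal_cdf: "strict_mono std_normal_cdf"
proof (rule strict_monoI)
  fix x y :: real assume "x < y"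
  then show "std_normal_cdf x < std_normal_cdf y"
    by (rule DERIV_pos_imp_increasing) (meson DERIV_std_normal_cdf normal_density_pos zero_less_one)
qed

lemma continuous_std_normal_cdf: "continuous_on S std_normal_cdf"
  by (meson DERIV_isCont DERIV_std_normal_cdf continuous_at_imp_continuous_on)

lemma std_normal_cdf_bounds: "0 < std_normal_cdf x" "std_normal_cdf x < 1"
proof -
  have "0 \<le> std_normal_cdf (x - 1)" "std_normal_cdf (x + 1) \<le> 1"
    by (auto simp: std_normal_cdf_def std_normal.cdf_nonneg std_normal.cdf_bounded_prob)
  then show "0 < std_normal_cdf x" "std_normal_cdf x < 1"
    using strict_monoD[OF strict_mono_std_normal_cdf, of "x - 1" x]
      strict_monoD[OF strict_mono_std_normal_cdf, of x "x + 1"] by auto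
qed

lemma quantile_std_normal_cdf [simp]: "quantile (std_normal_cdf x) = x"
  using std_normal_cdf_bounds[of x] strict_mono_imp_inj_on[OF strict_mono_std_normal_cdf]
  by (simp add: quantile_def)

lemma std_normal_cdf_quantile:
  assumes "0 < u" "u < 1"
  shows "std_normal_cdf (quantile u) = u"
proof -
  have "eventually (\<lambda>x. std_normal_cdf x < u) at_bot"
    using std_normal.cdf_lim_at_bot assms unfolding std_normal_cdf_def by (auto simp: order_tendsto_iff)
  then obtain a where a: "std_normal_cdf a < u"
    by (auto simp: eventually_at_bot_linorder)
  have "eventually (\<lambda>x. std_normal_cdf x > u) at_top"
    using std_normal.cdf_lim_at_top_prob assms unfolding std_normal_cdf_def by (auto simp: order_tendsto_iff)
  then obtain b where b: "u < std_normal_cdf b"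
    by (auto simp: eventually_at_top_linorder)
  have "a \<le> b"
    using a b strict_mono_less_eq[OF strict_mono_std_normal_cdf, of b a] by linarith
  then obtain x where "std_normal_cdf x = u"
    using IVT'[of std_normal_cdf a u b] a b continuous_std_normal_cdf by auto
  then show ?thesis by (metis quantile_std_normal_cdf)
qed

lemma quantile_le_iff:
  assumes "0 < u" "u < 1"
  shows "quantile u \<le> y \<longleftrightarrow> u \<le> std_normal_cdf y"
  by (metis assms std_normal_cdf_quantile strict_mono_less_eq strict_mono_std_normal_cdf)

lemma isCont_quantile:
  assumes "0 < u" "u < 1"
  shows "isCont quantile u"
proof -
  have near: "eventually (\<lambda>v. 0 < v \<and> v < 1) (at u)"
    using assms by (intro eventually_conj order_tendstoD[OF tendsto_ident_at]) auto
  have "(quantile \<longlongrightarrow> quantile u) (at u)"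
  proof (rule order_tendstoI)
    fix y assume "y < quantile u"
    then have "std_normal_cdf y < u"
      using quantile_le_iff[OF assms, of y] by linarith
    then have "eventually (\<lambda>v. std_normal_cdf y < v) (at u)"
      by (intro order_tendstoD[OF tendsto_ident_at])
    with near show "eventually (\<lambda>v. y < quantile v) (at u)"
      by eventually_elim (use quantile_le_iff linorder_not_le in blast)
  next
    fix y assume "quantile u < y"
    then have "u < std_normal_cdf y"
      by (metis assms std_normal_cdf_quantile strict_mono_less strict_mono_std_normal_cdf)
    then have "eventually (\<lambda>v. v < std_normal_cdf y) (at u)"
      by (intro order_tendstoD[OF tendsto_ident_at])
    with near show "eventually (\<lambda>v. quantile v < y) (at u)"
      by eventually_elim (metis std_normal_cdf_quantile strict_mono_less strict_mono_std_normal_cdf)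
  qed
  then show ?thesis by (simp add: isCont_def)
qed

lemma DERIV_quantile:
  assumes "0 < u" "u < 1"
  shows "(quantile has_real_derivative inverse (std_normal_density (quantile u))) (at u)"
  by (rule DERIV_inverse_function[where f = std_normal_cdf and a = 0 and b = 1])
     (use assms DERIV_std_normal_cdf isCont_quantile std_normal_cdf_quantile
         normal_density_pos[of 1 0 "quantile u"] in auto)

lemma measurable_quantile [measurable]: "quantile \<in> borel_measurable borel"
proof -
  have "continuous_on {0<..<1} quantile"
    by (auto intro!: continuous_at_imp_continuous_on isCont_quantile)
  then have "(\<lambda>u. indicator {0<..<1} u *\<^sub>R quantile u) \<in> borel_measurable borel"
    by (intro borel_measurable_continuous_on_indicator) auto
  \<comment> \<open>The value \<open>0\<close> chosen outside the unit interval makes this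
    hold.\<close>
  also have "(\<lambda>u. indicator {0<..<1} u *\<^sub>R quantile u) = quantile"
    by (auto simp: quantile_def indicator_def)
  finally show ?thesis .
qed

text \<open>\<open>S\<close> is any solution of the transport equation that fixes both endpoints; no
  distribution function enters. Twice the derivative of
  \<open>(S x - x) * std_normal_density (S x)\<close> stays below the difference of the two
  integrands, and it integrates to \<open>0\<close>.\<close>

lemma monotone_transport_ineq_Icc:
  fixes f S :: "real \<Rightarrow> real"
  assumes "a \<le> b" and cont: "continuous_on {a..b} f"
    and pos: "\<And>x. x \<in> {a..b} \<Longrightarrow> 0 < f x"
    and S: "\<And>x. x \<in> {a..b} \<Longrightarrow>
      (S has_real_derivative f x * std_normal_density x / std_normal_density (S x)) (at x within {a..b})"
    and "S a = a" "S b = b"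
  shows "integral {a..b} (\<lambda>x. f x * (x - S x)\<^sup>2 * std_normal_density x)
    \<le> 2 * integral {a..b} (\<lambda>x. f x * ln (f x) * std_normal_density x)"
proof -
  let ?d = std_normal_density
  have contS: "continuous_on {a..b} S"
    using S by (meson DERIV_continuous continuous_on_eq_continuous_within)
  have dpos: "?d x > 0" for x by (rule normal_density_pos) simp
  have derd: "(?d has_real_derivative - x * ?d x) (at x)" for x
    unfolding std_normal_density_def
    by (auto intro!: derivative_eq_intros simp: field_simps power2_eq_square)
  \<comment> \<open>Stein's identity \<open>\<integral> S (S - x) d\<nu> = \<integral> (1 - 1/S') d\<nu>\<close>, integrated by parts; \<open>S\<close> fixes both endpoints, so there
    are no boundary terms.\<close>
  have der: "((\<lambda>x. (S x - x) * ?d (S x)) has_real_derivative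
     f x * ?d x - ?d (S x) - S x * (S x - x) * (f x * ?d x)) (at x within {a..b})"
    if "x \<in> {a..b}" for x
    using dpos[of "S x"]
    by (auto intro!: derivative_eq_intros DERIV_chain2[OF derd] S that simp: field_simps)
  have "((\<lambda>x. f x * ?d x - ?d (S x) - S x * (S x - x) * (f x * ?d x)) has_integral
      (S b - b) * ?d (S b) - (S a - a) * ?d (S a)) {a..b}"
    using \<open>a \<le> b\<close> der by (intro fundamental_theorem_of_calculus)
      (auto simp: has_real_derivative_iff_has_vector_derivative)
  then have zero: "((\<lambda>x. f x * ?d x - ?d (S x) - S x * (S x - x) * (f x * ?d x)) has_integral 0) {a..b}"
    using assms by simp
  have contdS: "continuous_on {a..b} (\<lambda>x. ?d (S x))"
    by (rule continuous_on_compose2[OF continuous_on_std_normal_density contS]) auto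
  have lnf: "continuous_on {a..b} (\<lambda>x. ln (f x))"
    using pos by (intro continuous_on_ln cont) fastforce
  have i1: "(\<lambda>x. f x * (x - S x)\<^sup>2 * ?d x) integrable_on {a..b}"
    by (intro integrable_continuous_real continuous_intros cont contS continuous_on_std_normal_density)
  have i2: "(\<lambda>x. f x * ln (f x) * ?d x) integrable_on {a..b}"
    by (intro integrable_continuous_real continuous_intros cont lnf continuous_on_std_normal_density)
  have pointwise: "2 * (f x * ?d x - ?d (S x) - S x * (S x - x) * (f x * ?d x))
      \<le> 2 * (f x * ln (f x) * ?d x) - f x * (x - S x)\<^sup>2 * ?d x" if x: "x \<in> {a..b}" for x
  proof -
    \<comment> \<open>This is the derivative of \<open>S\<close> at \<open>x\<close>.\<close>
    define s where "s = f x * ?d x / ?d (S x)"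
    have "s > 0" using pos[OF x] dpos by (simp add: s_def)
    have "ln s = ln (f x) + ln (?d x) - ln (?d (S x))"
      using pos[OF x] dpos[of x] dpos[of "S x"] by (simp add: s_def ln_div ln_mult)
    moreover have "ln (?d y) = ln (1 / sqrt (2 * pi)) - y\<^sup>2 / 2" for y
      by (simp add: std_normal_density_def ln_div ln_mult)
    ultimately have lns: "ln (f x) = ln s + (x\<^sup>2 - (S x)\<^sup>2) / 2" by (simp add: field_simps)
    have "1 - 1 / s \<le> ln s"
      using ln_le_minus_one[of "1 / s"] \<open>s > 0\<close> by (simp add: ln_div)
    then have "(f x * ?d x) * (1 - 1 / s) \<le> (f x * ?d x) * ln s"
      using pos[OF x] dpos[of x] by (intro mult_left_mono) auto
    also have "(f x * ?d x) * (1 - 1 / s) = f x * ?d x - ?d (S x)"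
      using pos[OF x] dpos[of x] dpos[of "S x"] by (simp add: s_def field_simps)
    finally have "2 * (f x * ?d x - ?d (S x) - S x * (S x - x) * (f x * ?d x))
       \<le> 2 * ((f x * ?d x) * ln s - S x * (S x - x) * (f x * ?d x))" by simp
    \<comment> \<open>Completes the square: \<open>x*x - S*S\<close> minus the squared distance
      equals \<open>-2 * S * (S - x)\<close>.\<close>
    also have "\<dots> = 2 * (f x * ln (f x) * ?d x) - f x * (x - S x)\<^sup>2 * ?d x"
      unfolding lns by (simp add: field_simps power2_eq_square)
    finally show ?thesis .
  qed
  have "0 \<le> integral {a..b} (\<lambda>x. 2 * (f x * ln (f x) * ?d x) - f x * (x - S x)\<^sup>2 * ?d x)"
    by (rule has_integral_le[OF has_integral_mult_right[OF zero, of 2, simplified] integrable_integral])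
       (use pointwise i1 i2 in \<open>auto intro!: integrable_diff integrable_on_mult_right\<close>)
  also have "\<dots> = 2 * integral {a..b} (\<lambda>x. f x * ln (f x) * ?d x) - integral {a..b} (\<lambda>x. f x * (x - S x)\<^sup>2 * ?d x)"
    by (subst Henstock_Kurzweil_Integration.integral_diff) (use i1 i2 in \<open>auto intro: integrable_on_mult_right\<close>)
  finally show ?thesis by simp
qed

subsection \<open>General densities on the line\<close>

lemma (in finite_borel_measure) measurable_cdf: "cdf M \<in> borel_measurable M"
  using borel_measurable_mono[of "cdf M"] cdf_nondecreasing by (simp add: mono_def M_is_borel cong: measurable_cong_sets)

text \<open>The probability integral transform: under a law without atoms, its own distribution
  function is a uniform variable. The sublevel set is closed, bounded above and closed downwards,
  hence a half-line.\<close>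

lemma (in real_distribution) measure_cdf_le:
  assumes cont: "\<And>x. isCont (cdf M) x" and u: "0 < u" "u < 1"
  shows "measure M {x. cdf M x \<le> u} = u"
proof -
  have "eventually (\<lambda>x. cdf M x < u) at_bot"
    using cdf_lim_at_bot u by (auto simp: order_tendsto_iff)
  then obtain l where l: "cdf M l < u"
    by (auto simp: eventually_at_bot_linorder)
  have "eventually (\<lambda>x. cdf M x > u) at_top"
    using cdf_lim_at_top_prob u by (auto simp: order_tendsto_iff)
  then obtain r where r: "u < cdf M r"
    by (auto simp: eventually_at_top_linorder)
  have "l \<le> r"
    using l r cdf_nondecreasing[of r l] by linarith
  then obtain c where c: "cdf M c = u"
    using IVT'[of "cdf M" l u r] l r cont by (auto intro: continuous_at_imp_continuous_on)
  \<comment> \<open>The distribution function may be flat at height \<open>u\<close>, so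
    \<open>c\<close> need not be the right end of this set; its supremum is.\<close>
  define A where "A = {x. cdf M x \<le> u}"
  have "closed A"
    unfolding A_def by (intro closed_Collect_le continuous_intros continuous_at_imp_continuous_on ballI cont)
  have "bdd_above A"
    unfolding A_def bdd_above_def
  proof (intro exI ballI)
    show "x \<le> r" if "x \<in> {x. cdf M x \<le> u}" for x
      using that r cdf_nondecreasing[of r x] by (cases "x \<le> r") auto
  qed
  moreover have "c \<in> A" using c by (simp add: A_def)
  ultimately have sup: "Sup A \<in> A" "c \<le> Sup A"
    using \<open>closed A\<close> by (auto intro: closed_contains_Sup cSup_upper)
  have "A = {..Sup A}"
  proof (intro equalityI subsetI)
    show "x \<in> {..Sup A}" if "x \<in> A" for x
      using that \<open>bdd_above A\<close> by (simp add: cSup_upper)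
    show "x \<in> A" if "x \<in> {..Sup A}" for x
      using cdf_nondecreasing[of x "Sup A"] that sup by (simp add: A_def)
  qed
  then have "measure M A = cdf M (Sup A)" by (simp add: cdf_def)
  also have "\<dots> = u"
    using sup c cdf_nondecreasing[of c "Sup A"] by (auto simp: A_def)
  finally show ?thesis by (simp add: A_def)
qed

text \<open>Uniformity is known for \<open>0 < u < 1\<close>; letting \<open>u\<close> tend to
  \<open>0\<close> and to \<open>1\<close> excludes the end values, at which \<open>quantile\<close>
  is junk.\<close>

lemma (in real_distribution) AE_cdf_in_Ioo:
  assumes cont: "\<And>x. isCont (cdf M) x"
  shows "AE x in M. 0 < cdf M x \<and> cdf M x < 1"
proof -
  note [measurable] = measurable_cdf
  have le: "measure M {x. cdf M x \<le> 0} \<le> u" if "0 < u" "u < 1" for u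
  proof -
    have "measure M {x. cdf M x \<le> 0} \<le> measure M {x. cdf M x \<le> u}"
      using that by (intro finite_measure_mono) auto
    then show ?thesis using measure_cdf_le[OF cont that] by simp
  qed
  have "measure M {x. cdf M x \<le> 0} \<le> 0"
    by (rule dense_ge_bounded[of 0 1]) (use le in auto)
  then have "AE x in M. 0 < cdf M x"
    by (subst AE_iff_measurable[OF _ refl])
       (auto simp: emeasure_eq_measure not_less measure_le_0_iff)
  have ge: "u \<le> measure M {x. cdf M x < 1}" if "0 < u" "u < 1" for u
  proof -
    have "measure M {x. cdf M x \<le> u} \<le> measure M {x. cdf M x < 1}"
      using that by (intro finite_measure_mono) auto
    then show ?thesis using measure_cdf_le[OF cont that] by simp
  qed
  have "1 \<le> measure M {x. cdf M x < 1}"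
    by (rule dense_le_bounded[of 0 1]) (use ge in auto)
  then have "prob {x \<in> space M. cdf M x < 1} = 1"
    using prob_le_1 by (intro antisym) (auto simp del: prob_le_1)
  then have "AE x in M. cdf M x < 1"
    by (subst (asm) prob_Collect_eq_1) auto
  with \<open>AE x in M. 0 < cdf M x\<close> show ?thesis by auto
qed

text \<open>A uniform variable sent through the normal quantile is standard normal;
  \<open>quantile_le_iff\<close> compares the distribution functions, and the junk values of
  \<open>quantile\<close> occur only on a null set.\<close>

lemma (in real_distribution) distr_quantile_cdf:
  assumes cont: "\<And>x. isCont (cdf M) x"
  shows "distr M borel (\<lambda>x. quantile (cdf M x)) = std_normal"
proof (rule cdf_unique)
  note [measurable] = measurable_cdf
  show "real_distribution (distr M borel (\<lambda>x. quantile (cdf M x)))"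
    by (rule real_distribution_distr) auto
  show "real_distribution std_normal" ..
  show "cdf (distr M borel (\<lambda>x. quantile (cdf M x))) = cdf std_normal"
  proof
    fix y
    have "cdf (distr M borel (\<lambda>x. quantile (cdf M x))) y = measure M {x. quantile (cdf M x) \<le> y}"
      unfolding cdf_def[of "distr _ _ _"]
      by (subst measure_distr) (auto intro!: arg_cong[where f = "measure M"])
    also have "\<dots> = measure M {x. cdf M x \<le> std_normal_cdf y}"
    proof (rule measure_eq_AE)
      show "AE x in M. x \<in> {x. quantile (cdf M x) \<le> y} \<longleftrightarrow> x \<in> {x. cdf M x \<le> std_normal_cdf y}"
        using AE_cdf_in_Ioo[OF cont] by eventually_elim (simp add: quantile_le_iff)
    qed measurable
    also have "\<dots> = std_normal_cdf y"
      by (rule measure_cdf_le[OF cont std_normal_cdf_bounds])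
    finally show "cdf (distr M borel (\<lambda>x. quantile (cdf M x))) y = cdf std_normal y"
      by (simp add: std_normal_cdf_def)
  qed
qed

section \<open>Transport of a density to the Gaussian\<close>

locale normal_probability_density =
  fixes f :: "real \<Rightarrow> real"
  assumes integrable: "integrable std_normal f"
    and nonneg: "\<And>x. 0 \<le> f x"
    and integral_eq_1: "(\<integral>x. f x \<partial>std_normal) = 1"
begin

lemma measurable [measurable]: "f \<in> borel_measurable borel"
  using borel_measurable_integrable[OF integrable] by simp

abbreviation "N \<equiv> density std_normal f"

sublocale N: real_distribution N
proof (intro real_distribution.intro real_distribution_axioms.intro prob_spaceI)
  have "emeasure N (space N) = (\<integral>\<^sup>+x. f x \<partial>std_normal)"
    by (subst emeasure_density) (auto intro!: nn_integral_cong)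
  also have "\<dots> = 1"
    using integral_eq_1 nonneg by (subst nn_integral_eq_integral[OF integrable]) auto
  finally show "emeasure N (space N) = 1" .
qed auto

lemma cdf_eq: "cdf N x = (\<integral>y. f y * indicator {..x} y \<partial>std_normal)"
proof -
  have "cdf N x = (\<integral>y. indicator {..x} y \<partial>N)"
    by (simp add: cdf_def)
  also have "\<dots> = (\<integral>y. f y * indicator {..x} y \<partial>std_normal)"
    using nonneg by (subst integral_density) auto
  finally show ?thesis .
qed

lemma isCont_cdf: "isCont (cdf N) x"
proof -
  have "AE y in lborel. y \<noteq> x" by (rule AE_lborel_singleton)
  then have "AE y in N. y \<noteq> x"
    by (simp add: AE_density) (auto elim: eventually_mono)
  then have "measure N {x} = 0"
    by (subst measure_eq_0_null_sets) (auto simp: AE_iff_null_sets eventually_ae_filter)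
  then show ?thesis by (simp add: N.isCont_cdf)
qed

lemma transport_map_eq: "transport_map f = (\<lambda>x. quantile (cdf N x))"
  by (simp add: transport_map_def cdf_eq fun_eq_iff)

lemma distr_transport_map: "distr N borel (transport_map f) = std_normal"
  unfolding transport_map_eq by (rule N.distr_quantile_cdf[OF isCont_cdf])

lemma measurable_cdf [measurable]: "cdf N \<in> borel_measurable borel"
  using isCont_cdf by (auto intro!: borel_measurable_continuous_onI continuous_at_imp_continuous_on)

lemma measurable_transport_map [measurable]: "transport_map f \<in> borel_measurable borel"
  unfolding transport_map_eq by measurable

text \<open>To the left or right of the support the distribution function is \<open>0\<close> or
  \<open>1\<close> and the transport map is junk; there the weight \<open>f x\<close> removes the
  point from the cost.\<close>

lemma AE_cdf: "AE x in std_normal. f x = 0 \<or> (0 < cdf N x \<and> cdf N x < 1)"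
proof -
  have "AE x in std_normal. 0 < ennreal (f x) \<longrightarrow> (0 < cdf N x \<and> cdf N x < 1)"
    using N.AE_cdf_in_Ioo[OF isCont_cdf] by (subst (asm) AE_density) auto
  then show ?thesis
    by eventually_elim (use nonneg in \<open>auto simp: order.order_iff_strict\<close>)
qed

end

text \<open>Domination by \<open>w\<close> makes the distribution functions converge at every point,
  and continuity of \<open>quantile\<close> passes this on to the maps. Convergence of the entropies
  is assumed because Fatou's lemma only bounds the cost of the limit from above.\<close>

lemma transport_ineq_limit:
  fixes f w :: "real \<Rightarrow> real" and g :: "nat \<Rightarrow> real \<Rightarrow> real"
  assumes f: "normal_probability_density f"
    and g: "\<And>k. normal_probability_density (g k)"
    and conv: "AE x in std_normal. (\<lambda>k. g k x) \<longlonglongrightarrow> f x"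
    and w: "integrable std_normal w"
    and bound: "\<And>k. AE x in std_normal. g k x \<le> w x"
    and entropy: "(\<lambda>k. \<integral>x. g k x * ln (g k x) \<partial>std_normal) \<longlonglongrightarrow> (\<integral>x. f x * ln (f x) \<partial>std_normal)"
    and ineq: "\<And>k. transport_ineq (g k)"
  shows "transport_ineq f"
proof -
  interpret f: normal_probability_density f by fact
  interpret g: normal_probability_density "g k" for k by fact
  have [measurable]: "w \<in> borel_measurable borel"
    using borel_measurable_integrable[OF w] by simp
  have lim_cdf: "(\<lambda>k. cdf (g.N k) x) \<longlonglongrightarrow> cdf f.N x" for x
    unfolding f.cdf_eq g.cdf_eq
  proof (rule integral_dominated_convergence[where w = w])
    show "AE y in std_normal. (\<lambda>k. g k y * indicat_real {..x} y) \<longlonglongrightarrow> f y * indicat_real {..x} y"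
      using conv by eventually_elim (rule tendsto_mult_right)
    show "AE y in std_normal. norm (g k y * indicat_real {..x} y) \<le> w y" for k
      using bound[of k] by eventually_elim
        (use g.nonneg in \<open>auto simp: indicator_def intro: order.trans\<close>)
  qed (use w in auto)
  have "(\<integral>\<^sup>+x. ennreal (f x * (x - transport_map f x)\<^sup>2) \<partial>std_normal)
     \<le> (\<integral>\<^sup>+x. liminf (\<lambda>k. ennreal (g k x * (x - transport_map (g k) x)\<^sup>2)) \<partial>std_normal)"
  proof (rule nn_integral_mono_AE)
    show "AE x in std_normal. ennreal (f x * (x - transport_map f x)\<^sup>2)
        \<le> liminf (\<lambda>k. ennreal (g k x * (x - transport_map (g k) x)\<^sup>2))"
      using conv f.AE_cdf
    proof eventually_elim
      case (elim x)
      show ?case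
      \<comment> \<open>Where \<open>f x = 0\<close> the left side vanishes; elsewhere the limit of
        the distribution functions lies in the open unit interval, where \<open>quantile\<close> is
        continuous.\<close>
      proof (cases "f x = 0")
        case False
        with elim have x: "0 < cdf f.N x" "cdf f.N x < 1" by auto
        have "(\<lambda>k. transport_map (g k) x) \<longlonglongrightarrow> transport_map f x"
          unfolding f.transport_map_eq g.transport_map_eq
          by (rule isCont_tendsto_compose[OF isCont_quantile[OF x] lim_cdf])
        then have "(\<lambda>k. ennreal (g k x * (x - transport_map (g k) x)\<^sup>2)) \<longlonglongrightarrow>
            ennreal (f x * (x - transport_map f x)\<^sup>2)"
          using elim by (intro tendsto_intros) auto
        then show ?thesis
          by (simp add: lim_imp_Liminf)
      qed simp
    qed
  qed
  also have "\<dots> \<le> liminf (\<lambda>k. \<integral>\<^sup>+x. ennreal (g k x * (x - transport_map (g k) x)\<^sup>2) \<partial>std_normal)"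
    by (rule nn_integral_liminf) measurable
  also have "\<dots> \<le> liminf (\<lambda>k. ennreal (2 * (\<integral>x. g k x * ln (g k x) \<partial>std_normal)))"
    using ineq by (intro Liminf_mono) (auto simp: transport_ineq_def)
  also have "\<dots> = ennreal (2 * (\<integral>x. f x * ln (f x) \<partial>std_normal))"
    by (intro lim_imp_Liminf tendsto_ennrealI tendsto_intros entropy) auto
  finally show ?thesis by (simp add: transport_ineq_def)
qed

text \<open>
  Making the density equal to \<open>1\<close> off an interval of unchanged mass forces the transport map to be the
  identity there, which removes all boundary terms and integrability questions at infinity.
\<close>

lemma
  fixes g :: "real \<Rightarrow> real"
  assumes cont: "continuous_on {-R..R} g" and pos: "\<And>x. x \<in> {-R..R} \<Longrightarrow> 0 < g x" and "0 \<le> R"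
    and mass: "(\<integral>x. g x * indicator {-R..R} x \<partial>std_normal) = (\<integral>x. indicator {-R..R} x \<partial>std_normal)"
  defines "f \<equiv> \<lambda>x. if x \<in> {-R..R} then g x else 1"
  shows normal_probability_density_patch: "normal_probability_density f"
    and transport_ineq_patch: "transport_ineq f"
proof -
  let ?I = "{-R..R}"
  have f_eq: "f = (\<lambda>x. g x * indicator ?I x + (1 - indicator ?I x))"
    by (auto simp: f_def)
  have int_g: "integrable std_normal (\<lambda>x. g x * indicator ?I x)"
    by (rule integrable_std_normal_Icc[OF cont])
  have int_I: "integrable std_normal (indicator A :: real \<Rightarrow> real)" if "A \<in> sets borel" for A
    using that by (simp add: std_normal.emeasure_eq_measure)
  show dens: "normal_probability_density f"
  proof
    show "integrable std_normal f"
      unfolding f_eq using int_g int_I by auto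
    show "0 \<le> f x" for x
      using pos by (auto simp: f_def less_imp_le)
    have "(\<integral>x. f x \<partial>std_normal) = (\<integral>x. g x * indicator ?I x \<partial>std_normal) +
        ((\<integral>x. 1 \<partial>std_normal) - (\<integral>x. indicator ?I x \<partial>std_normal))"
      unfolding f_eq using int_g int_I[of ?I] by (simp del: integral_indicator)
    then show "(\<integral>x. f x \<partial>std_normal) = 1"
      using mass std_normal.prob_space by simp
  qed
  interpret normal_probability_density f by (rule dens)
  have contf: "continuous_on ?I f"
    using cont by (subst continuous_on_cong[OF refl, of _ f g]) (auto simp: f_def)
  have posf: "0 < f x" for x using pos by (auto simp: f_def)
  have F_left: "cdf N x = std_normal_cdf x" if "x \<le> -R" for x
    unfolding cdf_eq std_normal_cdf_eq
  proof (rule integral_cong_AE)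
    have "AE y in lborel. y \<noteq> -R" by (rule AE_lborel_singleton)
    then have "AE y in std_normal. y \<noteq> -R"
      by (simp add: AE_density) (auto elim: eventually_mono)
    then show "AE y in std_normal. f y * indicator {..x} y = indicator {..x} y"
      by eventually_elim (use that in \<open>auto simp: f_def indicator_def\<close>)
  qed auto
  have F_right: "cdf N x = std_normal_cdf x" if "x \<ge> R" for x
  proof -
    \<comment> \<open>Beyond \<open>x\<close> the density is \<open>1\<close>, so cutting off its
      tail means subtracting the Gaussian tail from the total mass.\<close>
    have "cdf N x = (\<integral>y. f y + (indicator {..x} y - 1) \<partial>std_normal)"
      unfolding cdf_eq using that \<open>0 \<le> R\<close>
      by (intro Bochner_Integration.integral_cong) (auto simp: f_def indicator_def)
    also have "\<dots> = (\<integral>y. f y \<partial>std_normal) + ((\<integral>y. indicator {..x} y \<partial>std_normal) - (\<integral>y. 1 \<partial>std_normal))"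
      using integrable int_I[of "{..x}"] by (simp del: integral_indicator)
    also have "\<dots> = std_normal_cdf x"
      using integral_eq_1 std_normal.prob_space by (simp add: std_normal_cdf_eq)
    finally show ?thesis .
  qed
  define S where "S = transport_map f"
  have S_out: "S x = x" if "x \<le> -R \<or> R \<le> x" for x
    using that F_left F_right by (auto simp: S_def transport_map_eq)
  \<comment> \<open>By monotonicity the values lie between those at the endpoints, which are the
    Gaussian ones and hence interior.\<close>
  have F_in: "0 < cdf N x" "cdf N x < 1" if "x \<in> ?I" for x
    using that F_left[of "-R"] F_right[of R] N.cdf_nondecreasing[of "-R" x] N.cdf_nondecreasing[of x R]
      std_normal_cdf_bounds[of R] std_normal_cdf_bounds[of "-R"] by auto
  have derS: "(S has_real_derivative f x * std_normal_density x / std_normal_density (S x)) (at x within ?I)"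
    if x: "x \<in> ?I" for x
  proof -
    have "(cdf N has_real_derivative f x * std_normal_density x) (at x within ?I)"
      using DERIV_indicator_atMost_integral[OF integrable contf x] by (simp add: cdf_eq[abs_def])
    from DERIV_chain2[OF DERIV_quantile[OF F_in[OF x]] this] show ?thesis
      by (simp add: S_def transport_map_eq field_simps)
  qed
  have contS: "continuous_on ?I S"
    using derS by (meson DERIV_continuous continuous_on_eq_continuous_within)
  have contlnf: "continuous_on ?I (\<lambda>x. ln (f x))"
    using posf by (intro continuous_on_ln contf) (auto simp: less_imp_neq[symmetric])
  have c1: "continuous_on ?I (\<lambda>x. f x * (x - S x)\<^sup>2)" and c2: "continuous_on ?I (\<lambda>x. f x * ln (f x))"
    by (intro continuous_intros contf contS contlnf)+
  have "(\<integral>\<^sup>+x. ennreal (f x * (x - transport_map f x)\<^sup>2) \<partial>std_normal) =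
      (\<integral>\<^sup>+x. ennreal ((f x * (x - S x)\<^sup>2) * indicator ?I x) \<partial>std_normal)"
    using S_out by (intro nn_integral_cong) (auto simp: S_def indicator_def)
  also have "\<dots> = ennreal (\<integral>x. (f x * (x - S x)\<^sup>2) * indicator ?I x \<partial>std_normal)"
    using nonneg by (intro nn_integral_eq_integral integrable_std_normal_Icc c1) auto
  also have "\<dots> = ennreal (integral ?I (\<lambda>x. f x * (x - S x)\<^sup>2 * std_normal_density x))"
    by (subst integral_std_normal_Icc[OF c1]) simp
  also have "\<dots> \<le> ennreal (2 * integral ?I (\<lambda>x. f x * ln (f x) * std_normal_density x))"
    using \<open>0 \<le> R\<close> posf S_out by (intro ennreal_leI monotone_transport_ineq_Icc contf derS) auto
  also have "integral ?I (\<lambda>x. f x * ln (f x) * std_normal_density x) =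
      (\<integral>x. (f x * ln (f x)) * indicator ?I x \<partial>std_normal)"
    by (subst integral_std_normal_Icc[OF c2]) simp
  also have "\<dots> = (\<integral>x. f x * ln (f x) \<partial>std_normal)"
    by (intro Bochner_Integration.integral_cong) (auto simp: f_def indicator_def)
  finally show "transport_ineq f" by (simp add: transport_ineq_def)
qed

section \<open>Approximation of general densities\<close>

lemma continuous_on_mult_ln: "continuous_on {0..} (\<lambda>x::real. x * ln x)"
  unfolding continuous_on_eq_continuous_within
proof
  fix x :: real assume "x \<in> {0..}"
  show "continuous (at x within {0..}) (\<lambda>x. x * ln x)"
  proof (cases "x = 0")
    case True
    have "((\<lambda>x::real. x * ln x) \<longlongrightarrow> 0) (at_right 0)" by real_asymp
    moreover have "at (0::real) within {0..} = at_right 0"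
      unfolding at_within_def by (rule arg_cong[where f = "\<lambda>A. inf _ (principal A)"]) auto
    ultimately show ?thesis using True by (simp add: continuous_within)
  next
    case False
    then show ?thesis using \<open>x \<in> {0..}\<close> by (intro continuous_intros) auto
  qed
qed

lemma tendsto_mult_ln:
  fixes a :: real
  assumes "(f \<longlongrightarrow> a) F" "eventually (\<lambda>x. 0 \<le> f x) F" "0 \<le> a"
  shows "((\<lambda>x. f x * ln (f x)) \<longlongrightarrow> a * ln a) F"
  using continuous_on_tendsto_compose[OF continuous_on_mult_ln assms(1)] assms by auto

lemma AE_std_normal_iff: "(AE x in std_normal. P x) \<longleftrightarrow> (AE x in lborel. P x)"
  using normal_density_pos[of 1 0] by (subst AE_density) auto

text \<open>\<open>measurable_on\<close> is by definition approximation by continuous functions off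
  a negligible set, and the Gaussian has the same null sets as Lebesgue measure.\<close>

lemma borel_measurable_AE_limit_continuous:
  fixes f :: "real \<Rightarrow> real"
  assumes "f \<in> borel_measurable borel"
  obtains g where "\<And>k. continuous_on UNIV (g k)" "AE x in std_normal. (\<lambda>k. g k x) \<longlonglongrightarrow> f x"
proof -
  have "f measurable_on UNIV"
    using assms by (intro lebesgue_measurable_imp_measurable_on measurable_completion) auto
  then obtain N g where g: "negligible N" "\<And>n. continuous_on UNIV (g n)"
     "\<And>x. x \<notin> N \<Longrightarrow> (\<lambda>n. g n x) \<longlonglongrightarrow> f x"
    unfolding measurable_on_def by auto
  then have "AE x in lebesgue. (\<lambda>n. g n x) \<longlonglongrightarrow> f x"
    by (intro AE_I'[of N]) (auto simp: negligible_iff_null_sets)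
  then have "AE x in std_normal. (\<lambda>n. g n x) \<longlonglongrightarrow> f x"
    unfolding AE_std_normal_iff by (simp add: AE_completion_iff)
  with g that show ?thesis by blast
qed

text \<open>The approximants are continuous functions clamped to \<open>[m, M]\<close>, restricted
  to growing intervals, rescaled there to the Gaussian mass and set to \<open>1\<close> outside.
  Clamping gives bounds uniform in \<open>k\<close>, so constants dominate both densities and
  entropies.\<close>

lemma transport_ineq_bounded:
  assumes f: "normal_probability_density f" and "0 < m" and bounds: "\<And>x. m \<le> f x" "\<And>x. f x \<le> M"
  shows "transport_ineq f"
proof -
  interpret normal_probability_density f by fact
  obtain g where g: "\<And>k. continuous_on UNIV (g k)" "AE x in std_normal. (\<lambda>k. g k x) \<longlonglongrightarrow> f x"
    using borel_measurable_AE_limit_continuous[OF measurable] by blast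
  have "m \<le> M" using bounds[of 0] by linarith
  \<comment> \<open>The summand \<open>1\<close> keeps the interval nondegenerate at
    \<open>k = 0\<close>, so that every \<open>p k\<close> is positive.\<close>
  define I where "I k = {-(1 + real k)..1 + real k}" for k
  define h where "h k x = max m (min M (g k x))" for k x
  define Z where "Z k = (\<integral>x. h k x * indicator (I k) x \<partial>std_normal)" for k
  define p where "p k = (\<integral>x. (indicator (I k) x :: real) \<partial>std_normal)" for k
  define q where "q k x = (if x \<in> I k then p k / Z k * h k x else 1)" for k x
  have conth: "continuous_on A (h k)" for k A
    unfolding h_def by (intro continuous_intros continuous_on_subset[OF g(1)]) auto
  have [measurable]: "h k \<in> borel_measurable borel" for k
    by (intro borel_measurable_continuous_onI conth)
  have [measurable]: "I k \<in> sets borel" for k by (simp add: I_def)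
  have h_bounds: "m \<le> h k x" "h k x \<le> M" for k x
    using \<open>m \<le> M\<close> by (auto simp: h_def)
  have indicator_lim: "(\<lambda>k. indicator (I k) x :: real) \<longlonglongrightarrow> 1" for x
  proof (rule tendsto_eventually)
    obtain n where "\<bar>x\<bar> \<le> real n" using real_arch_simple by blast
    then show "eventually (\<lambda>k. indicator (I k) x = (1::real)) sequentially"
      by (intro eventually_sequentiallyI[of n]) (auto simp: I_def indicator_def)
  qed
  have h_lim: "AE x in std_normal. (\<lambda>k. h k x) \<longlonglongrightarrow> f x"
    using g(2)
  proof eventually_elim
    case (elim x)
    then have "(\<lambda>k. h k x) \<longlonglongrightarrow> max m (min M (f x))"
      unfolding h_def by (intro tendsto_intros)
    then show ?case using bounds[of x] by simp
  qed
  have p_lim: "p \<longlonglongrightarrow> (\<integral>x. 1 \<partial>std_normal)"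
    unfolding p_def[abs_def]
    by (rule integral_dominated_convergence[where w = "\<lambda>_. 1"]) (auto intro: indicator_lim)
  have Z_lim: "Z \<longlonglongrightarrow> (\<integral>x. f x \<partial>std_normal)"
    unfolding Z_def[abs_def]
  proof (rule integral_dominated_convergence[where w = "\<lambda>_. M"])
    show "AE x in std_normal. (\<lambda>k. h k x * indicator (I k) x) \<longlonglongrightarrow> f x"
      using h_lim
    proof eventually_elim
      case (elim x)
      then show ?case using tendsto_mult[OF elim indicator_lim[of x]] by simp
    qed
    show "AE x in std_normal. norm (h k x * indicator (I k) x) \<le> M" for k
      using h_bounds[of k] \<open>0 < m\<close> \<open>m \<le> M\<close>
      by (intro always_eventually allI) (auto simp: indicator_def abs_le_iff intro: order.trans[of _ m], smt (verit) h_bounds)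
  qed auto
  have p_pos: "0 < p k" for k
  proof -
    have "0 < std_normal_cdf (1 + real k) - std_normal_cdf (- (1 + real k))"
      using strict_monoD[OF strict_mono_std_normal_cdf, of "- (1 + real k)" "1 + real k"] by simp
    also have "\<dots> = measure std_normal {-(1 + real k)<..1 + real k}"
      unfolding std_normal_cdf_def by (rule std_normal.cdf_diff_eq) simp
    also have "\<dots> \<le> measure std_normal {-(1 + real k)..1 + real k}"
      by (intro std_normal.finite_measure_mono) auto
    also have "\<dots> = p k" by (simp add: p_def I_def)
    finally show ?thesis .
  qed
  have int_I: "integrable std_normal (indicator (I k) :: real \<Rightarrow> real)" for k
    by (simp add: std_normal.emeasure_eq_measure)
  have int_h: "integrable std_normal (\<lambda>x. h k x * indicator (I k) x)" for k
    unfolding I_def by (intro integrable_std_normal_Icc conth)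
  have "(\<integral>x. m * indicator (I k) x \<partial>std_normal) \<le> Z k" for k
    unfolding Z_def
    by (intro integral_mono integrable_mult_right int_I int_h mult_right_mono h_bounds) auto
  then have Z_ge: "m * p k \<le> Z k" for k unfolding p_def by simp
  have "Z k \<le> (\<integral>x. M * indicator (I k) x \<partial>std_normal)" for k
    unfolding Z_def
    by (intro integral_mono integrable_mult_right int_I int_h mult_right_mono h_bounds) auto
  then have Z_le: "Z k \<le> M * p k" for k unfolding p_def by simp
  have Z_pos: "0 < Z k" for k
    using Z_ge[of k] p_pos[of k] \<open>0 < m\<close> by (smt (verit) mult_pos_pos)
  have q: "normal_probability_density (q k) \<and> transport_ineq (q k)" for k
  proof -
    have mass: "(\<integral>x. p k / Z k * h k x * indicator (I k) x \<partial>std_normal) = (\<integral>x. indicator (I k) x \<partial>std_normal)"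
      unfolding mult.assoc integral_mult_right_zero Z_def[symmetric] p_def[symmetric]
      using Z_pos[of k] by simp
    have pos: "0 < p k / Z k * h k x" for x
      using p_pos[of k] Z_pos[of k] h_bounds[of k x] \<open>0 < m\<close> by (intro mult_pos_pos divide_pos_pos) linarith+
    show ?thesis
      unfolding q_def[abs_def] I_def
      by (intro conjI normal_probability_density_patch transport_ineq_patch mass[unfolded I_def] pos
          continuous_intros conth) auto
  qed
  then interpret q: normal_probability_density "q k" for k by blast
  have c_bounds: "1 / M \<le> p k / Z k" "p k / Z k \<le> 1 / m" for k
    using Z_ge[of k] Z_le[of k] Z_pos[of k] \<open>0 < m\<close> \<open>m \<le> M\<close> by (auto simp: field_simps)
  \<comment> \<open>The factors lie in \<open>[1 / M, 1 / m]\<close> and \<open>[m, M]\<close>, and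
    the outer value \<open>1\<close> fits since \<open>m \<le> M\<close>. The two bounds are
    reciprocal, so \<open>ln (M / m)\<close> bounds the logarithm in absolute value.\<close>
  have q_bounds: "m / M \<le> q k x" "q k x \<le> M / m" for k x
  proof -
    have "1 / M * m \<le> p k / Z k * h k x" "p k / Z k * h k x \<le> 1 / m * M"
      using c_bounds[of k] h_bounds[of k x] \<open>0 < m\<close> \<open>m \<le> M\<close> p_pos[of k] Z_pos[of k]
      by (intro mult_mono; force)+
    then show "m / M \<le> q k x" "q k x \<le> M / m"
      using \<open>0 < m\<close> \<open>m \<le> M\<close> by (auto simp: q_def field_simps)
  qed
  have q_lim: "AE x in std_normal. (\<lambda>k. q k x) \<longlonglongrightarrow> f x"
    using h_lim
  proof eventually_elim
    case (elim x)
    have "(\<lambda>k. p k / Z k * h k x) \<longlonglongrightarrow> 1 / 1 * f x"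
      using p_lim Z_lim integral_eq_1 std_normal.prob_space elim by (intro tendsto_intros) auto
    moreover have "eventually (\<lambda>k. p k / Z k * h k x = q k x) sequentially"
      using order_tendstoD(1)[OF indicator_lim[of x], of "1/2"]
      by (auto simp: q_def indicator_def elim!: eventually_mono split: if_splits)
    ultimately show ?case using tendsto_cong by force
  qed
  show ?thesis
  proof (rule transport_ineq_limit[OF f _ q_lim, where w = "\<lambda>_. M / m"])
    show "(\<lambda>k. \<integral>x. q k x * ln (q k x) \<partial>std_normal) \<longlonglongrightarrow> (\<integral>x. f x * ln (f x) \<partial>std_normal)"
    proof (rule integral_dominated_convergence[where w = "\<lambda>_. M / m * ln (M / m)"])
      show "AE x in std_normal. (\<lambda>k. q k x * ln (q k x)) \<longlonglongrightarrow> f x * ln (f x)"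
        using q_lim by eventually_elim (use q.nonneg nonneg in \<open>auto intro!: tendsto_mult_ln\<close>)
      show "AE x in std_normal. norm (q k x * ln (q k x)) \<le> M / m * ln (M / m)" for k
      proof (intro always_eventually allI)
        fix x
        have "0 < m / M" using \<open>0 < m\<close> \<open>m \<le> M\<close> by simp
        then have "0 < q k x" using q_bounds(1)[of k x] by linarith
        then have "ln (m / M) \<le> ln (q k x)" "ln (q k x) \<le> ln (M / m)"
          using q_bounds[of k x] \<open>0 < m\<close> \<open>m \<le> M\<close> by (auto intro!: ln_mono simp: less_le_trans)
        moreover have "ln (m / M) = - ln (M / m)" using \<open>0 < m\<close> \<open>m \<le> M\<close> by (simp add: ln_div)
        ultimately have "\<bar>ln (q k x)\<bar> \<le> ln (M / m)" by linarith
        then show "norm (q k x * ln (q k x)) \<le> M / m * ln (M / m)"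
          using q_bounds(2)[of k x] q.nonneg[of k x] mult_mono[of "q k x" "M / m" "\<bar>ln (q k x)\<bar>" "ln (M / m)"]
          by (simp add: abs_mult)
      qed
    qed (use q.measurable in auto)
  qed (use q q_bounds in auto)
qed

text \<open>Truncation between \<open>1 / (1 + real k)\<close> and \<open>1 + real k\<close>,
  followed by normalization, reduces to bounded densities; the normalizing masses tend to
  \<open>1\<close> and contribute nothing to the limiting entropy.\<close>

theorem transport_ineq_entropy:
  assumes f: "normal_probability_density f" and ent: "integrable std_normal (\<lambda>x. f x * ln (f x))"
  shows "transport_ineq f"
proof -
  interpret normal_probability_density f by fact
  define c where "c k x = max (1 / (1 + real k)) (min (1 + real k) (f x))" for k x
  define Z where "Z k = (\<integral>x. c k x \<partial>std_normal)" for k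
  have [measurable]: "c k \<in> borel_measurable borel" for k
    unfolding c_def[abs_def] by measurable
  have c_pos: "0 < c k x" for k x by (auto simp: c_def less_max_iff_disj)
  have c_le: "c k x \<le> f x + 1" for k x
  proof -
    have "1 / (1 + real k) \<le> 1" by simp
    also have "1 \<le> f x + 1" using nonneg[of x] by simp
    finally show ?thesis by (auto simp: c_def intro: min.coboundedI2)
  qed
  have c_lim: "(\<lambda>k. c k x) \<longlonglongrightarrow> f x" for x
  proof -
    have "eventually (\<lambda>k. f x \<le> 1 + real k) sequentially" by real_asymp
    then have "eventually (\<lambda>k. max (1 / (1 + real k)) (f x) = c k x) sequentially"
      by eventually_elim (simp add: c_def)
    moreover have "(\<lambda>k. 1 / (1 + real k)) \<longlonglongrightarrow> 0" by real_asymp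
    then have "(\<lambda>k. max (1 / (1 + real k)) (f x)) \<longlonglongrightarrow> max 0 (f x)"
      by (intro tendsto_intros)
    ultimately show ?thesis
      using nonneg[of x] by (simp add: Lim_transform_eventually)
  qed
  have int_f1: "integrable std_normal (\<lambda>x. f x + 1)" using integrable by simp
  have int_c: "integrable std_normal (c k)" for k
    by (rule Bochner_Integration.integrable_bound[OF int_f1])
       (use c_pos c_le in \<open>auto simp: abs_of_pos intro!: always_eventually order.trans[OF _ abs_ge_self]\<close>)
  have Z_lim: "Z \<longlonglongrightarrow> (\<integral>x. f x \<partial>std_normal)"
    unfolding Z_def[abs_def]
    by (rule integral_dominated_convergence[OF _ _ int_f1])
       (auto intro!: always_eventually c_lim c_le simp: abs_of_pos[OF c_pos])
  then have Z_lim: "Z \<longlonglongrightarrow> 1"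
    unfolding integral_eq_1 .
  \<comment> \<open>A uniform lower bound on the masses is needed to dominate the normalized
    densities, by \<open>2 * (f x + 1)\<close>; the shift by \<open>K\<close> drops the initial
    terms.\<close>
  then have "eventually (\<lambda>k. 1 / 2 < Z k) sequentially"
    by (rule order_tendstoD) simp
  then obtain K where K: "\<And>k. 1 / 2 < Z (k + K)"
    unfolding eventually_sequentially by (metis le_add2)
  \<comment> \<open>At the lower cutoff the value is at most \<open>1\<close> in size; at the upper
    one \<open>t * ln t\<close> is increasing on \<open>t \<ge> 1\<close>, so cutting only decreases
    it.\<close>
  have clnc_bound: "\<bar>c k x * ln (c k x)\<bar> \<le> \<bar>f x * ln (f x)\<bar> + 1" for k x
  proof -
    consider "c k x = f x" | "c k x = 1 / (1 + real k)" | "c k x = 1 + real k" "1 + real k \<le> f x"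
      unfolding c_def max_def min_def by (metis linorder_linear)
    then show ?thesis
    proof cases
      case 2
      have "ln (1 + real k) \<le> 1 + real k" by (rule ln_bound) simp
      then show ?thesis unfolding 2 by (simp add: ln_div abs_mult add_increasing)
    next
      case 3
      have "(1 + real k) * ln (1 + real k) \<le> f x * ln (f x)"
        using 3 by (intro mult_mono) auto
      moreover have "0 \<le> (1 + real k) * ln (1 + real k)" by simp
      ultimately show ?thesis unfolding 3 by linarith
    qed auto
  qed
  have int_bound: "integrable std_normal (\<lambda>x. \<bar>f x * ln (f x)\<bar> + 1)"
    using ent by simp
  have int_clnc: "integrable std_normal (\<lambda>x. c k x * ln (c k x))" for k
    by (rule Bochner_Integration.integrable_bound[OF int_bound])
       (use clnc_bound in \<open>auto intro!: always_eventually order.trans[OF _ abs_ge_self]\<close>)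
  have clnc_lim: "(\<lambda>k. \<integral>x. c k x * ln (c k x) \<partial>std_normal) \<longlonglongrightarrow> (\<integral>x. f x * ln (f x) \<partial>std_normal)"
    by (rule integral_dominated_convergence[OF _ _ int_bound])
       (auto intro!: always_eventually tendsto_mult_ln c_lim nonneg clnc_bound less_imp_le[OF c_pos]
          simp del: abs_mult)
  define g where "g k x = c (k + K) x / Z (k + K)" for k x
  have Z_pos: "0 < Z (k + K)" for k using K[of k] by linarith
  have dens: "normal_probability_density (g k)" for k
    using Z_pos[of k] c_pos[of "k + K"] int_c[of "k + K"]
    by unfold_locales (auto simp: g_def[abs_def] Z_def[symmetric] less_imp_le)
  show ?thesis
  proof (rule transport_ineq_limit[OF f dens])
    show "AE x in std_normal. (\<lambda>k. g k x) \<longlonglongrightarrow> f x"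
    proof (intro always_eventually allI)
      fix x
      have "(\<lambda>k. g k x) \<longlonglongrightarrow> f x / 1"
        unfolding g_def by (intro tendsto_divide LIMSEQ_ignore_initial_segment[OF c_lim]
            LIMSEQ_ignore_initial_segment[OF Z_lim]) auto
      then show "(\<lambda>k. g k x) \<longlonglongrightarrow> f x" by simp
    qed
    show "integrable std_normal (\<lambda>x. 2 * (f x + 1))" using int_f1 by (rule integrable_mult_right)
    show "AE x in std_normal. g k x \<le> 2 * (f x + 1)" for k
    proof (intro always_eventually allI)
      fix x
      have "g k x \<le> c (k + K) x / (1 / 2)"
        unfolding g_def using K[of k] c_pos[of "k + K" x] by (intro divide_left_mono) auto
      then show "g k x \<le> 2 * (f x + 1)" using c_le[of "k + K" x] by simp
    qed
    have "(\<integral>x. g k x * ln (g k x) \<partial>std_normal) =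
        (\<integral>x. c (k + K) x * ln (c (k + K) x) \<partial>std_normal) / Z (k + K) - ln (Z (k + K))" for k
    proof -
      have "g k x * ln (g k x) = c (k + K) x * ln (c (k + K) x) / Z (k + K) -
          c (k + K) x * (ln (Z (k + K)) / Z (k + K))" for x
        using Z_pos[of k] c_pos[of "k + K" x] by (simp add: g_def ln_div field_simps)
      then show ?thesis
        using int_clnc[of "k + K"] int_c[of "k + K"] Z_pos[of k] by (simp add: Z_def[symmetric])
    qed
    moreover have "(\<lambda>k. (\<integral>x. c (k + K) x * ln (c (k + K) x) \<partial>std_normal) / Z (k + K) - ln (Z (k + K)))
        \<longlonglongrightarrow> (\<integral>x. f x * ln (f x) \<partial>std_normal) / 1 - ln 1"
      by (intro tendsto_intros LIMSEQ_ignore_initial_segment[OF Z_lim]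
          LIMSEQ_ignore_initial_segment[OF clnc_lim]) auto
    ultimately show "(\<lambda>k. \<integral>x. g k x * ln (g k x) \<partial>std_normal) \<longlonglongrightarrow> (\<integral>x. f x * ln (f x) \<partial>std_normal)"
      by simp
    show "transport_ineq (g k)" for k
    proof (rule transport_ineq_bounded[OF dens])
      show "0 < 1 / (1 + real (k + K)) / Z (k + K)" using Z_pos[of k] by simp
      show "1 / (1 + real (k + K)) / Z (k + K) \<le> g k x" for x
        unfolding g_def c_def using Z_pos[of k] by (intro divide_right_mono) auto
      have "c (k + K) x \<le> 1 + real (k + K)" for x
        unfolding c_def by (auto simp: divide_simps) (smt (verit) mult_le_cancel_left1 of_nat_0_le_iff)
      then show "g k x \<le> (1 + real (k + K)) / Z (k + K)" for x
        unfolding g_def using Z_pos[of k] by (intro divide_right_mono) auto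
    qed
  qed
qed

text \<open>The left side is the tangent at \<open>1\<close> of the convex function on the
  right.\<close>

lemma mult_ln_ge:
  fixes t :: real
  assumes "0 \<le> t"
  shows "t - 1 \<le> t * ln t"
proof (cases "t = 0")
  case False
  then have "0 < t" using assms by simp
  have "ln (1 / t) \<le> 1 / t - 1" using \<open>0 < t\<close> by (intro ln_le_minus_one) simp
  then have "t * (1 - 1 / t) \<le> t * ln t"
    using \<open>0 < t\<close> by (intro mult_left_mono) (auto simp: ln_div)
  then show ?thesis using \<open>0 < t\<close> by (simp add: right_diff_distrib)
qed simp

lemma (in prob_space) entropy_nonneg:
  fixes f :: "'a \<Rightarrow> real"
  assumes "integrable M f" "\<And>x. 0 \<le> f x" "(\<integral>x. f x \<partial>M) = 1" "integrable M (\<lambda>x. f x * ln (f x))"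
  shows "0 \<le> (\<integral>x. f x * ln (f x) \<partial>M)"
proof -
  have "(\<integral>x. f x - 1 \<partial>M) \<le> (\<integral>x. f x * ln (f x) \<partial>M)"
    using assms by (intro integral_mono mult_ln_ge) auto
  then show ?thesis using assms prob_space by simp
qed

subsection \<open>Tensorization\<close>

text \<open>In the fibres of a disintegration the total mass \<open>c\<close> varies and may vanish.\<close>

lemma transport_map_scaled:
  fixes h :: "real \<Rightarrow> real"
  assumes int: "integrable std_normal h" and ent: "integrable std_normal (\<lambda>y. h y * ln (h y))"
    and nonneg: "\<And>y. 0 \<le> h y"
  defines "c \<equiv> \<integral>y. h y \<partial>std_normal" and "S \<equiv> transport_map (\<lambda>y. h y / (\<integral>y. h y \<partial>std_normal))"
  shows "c * ln c \<le> (\<integral>y. h y * ln (h y) \<partial>std_normal)"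
    and "(\<integral>\<^sup>+y. ennreal (h y) * ennreal ((y - S y)\<^sup>2) \<partial>std_normal)
      \<le> ennreal (2 * ((\<integral>y. h y * ln (h y) \<partial>std_normal) - c * ln c))"
    and "u \<in> borel_measurable borel \<Longrightarrow>
      (\<integral>\<^sup>+y. ennreal (h y) * u (S y) \<partial>std_normal) = ennreal c * (\<integral>\<^sup>+y. u y \<partial>std_normal)"
proof -
  have "c * ln c \<le> (\<integral>y. h y * ln (h y) \<partial>std_normal) \<and>
    (\<integral>\<^sup>+y. ennreal (h y) * ennreal ((y - S y)\<^sup>2) \<partial>std_normal)
      \<le> ennreal (2 * ((\<integral>y. h y * ln (h y) \<partial>std_normal) - c * ln c)) \<and>
    (u \<in> borel_measurable borel \<longrightarrow>
      (\<integral>\<^sup>+y. ennreal (h y) * u (S y) \<partial>std_normal) = ennreal c * (\<integral>\<^sup>+y. u y \<partial>std_normal))"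
  \<comment> \<open>For \<open>c = 0\<close> the normalized density is junk, but \<open>h\<close>
    vanishes almost everywhere, and with it all integrals against it.\<close>
  proof (cases "c = 0")
    case True
    then have ae: "AE y in std_normal. h y = 0"
      using nonneg by (subst (asm) c_def, subst (asm) integral_nonneg_eq_0_iff_AE[OF int]) auto
    have "(\<integral>y. h y * ln (h y) \<partial>std_normal) = 0"
      using ae by (intro integral_eq_zero_AE) (auto elim: eventually_mono)
    moreover have "(\<integral>\<^sup>+y. ennreal (h y) * v y \<partial>std_normal) = (\<integral>\<^sup>+y. 0 \<partial>std_normal)" for v :: "real \<Rightarrow> ennreal"
      using ae by (intro nn_integral_cong_AE) (auto elim: eventually_mono)
    ultimately show ?thesis using True by simp
  next
    case False
    moreover have "0 \<le> c" unfolding c_def using nonneg by (intro integral_nonneg_AE) auto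
    ultimately have c: "0 < c" by simp
    define f where "f y = h y / c" for y
    interpret normal_probability_density f
      using int nonneg c by unfold_locales (auto simp: f_def[abs_def] c_def[symmetric])
    have S_eq: "S = transport_map f" by (simp add: S_def f_def[abs_def] c_def)
    \<comment> \<open>Normalizing shifts the logarithm by \<open>ln c\<close>; after integration
      this is the correction \<open>c * ln c\<close>.\<close>
    have f_ln: "f y * ln (f y) = h y * ln (h y) / c - h y * (ln c / c)" for y
      using c nonneg[of y] by (cases "h y = 0") (auto simp: f_def ln_div field_simps)
    have int_f_ln: "integrable std_normal (\<lambda>y. f y * ln (f y))"
      unfolding f_ln using int ent by simp
    have ent_f: "(\<integral>y. f y * ln (f y) \<partial>std_normal) = ((\<integral>y. h y * ln (h y) \<partial>std_normal) - c * ln c) / c"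
      unfolding f_ln using int ent c by (simp add: c_def[symmetric] diff_divide_distrib)
    have h_eq: "ennreal (h y) = ennreal c * ennreal (f y)" for y
      using c nonneg[of y] by (simp add: f_def ennreal_mult[symmetric])
    have scale: "(\<integral>\<^sup>+y. ennreal (h y) * v y \<partial>std_normal) = ennreal c * (\<integral>\<^sup>+y. ennreal (f y) * v y \<partial>std_normal)"
      if [measurable]: "v \<in> borel_measurable borel" for v
      unfolding h_eq mult.assoc by (rule nn_integral_cmult) simp
    have "0 \<le> (\<integral>y. f y * ln (f y) \<partial>std_normal)"
      by (rule std_normal.entropy_nonneg[OF integrable nonneg integral_eq_1 int_f_ln])
    then have 1: "c * ln c \<le> (\<integral>y. h y * ln (h y) \<partial>std_normal)"
      using c by (simp add: ent_f zero_le_divide_iff)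
    have "transport_ineq f"
      by (rule transport_ineq_entropy) (use int_f_ln normal_probability_density_axioms in auto)
    then have "(\<integral>\<^sup>+y. ennreal (f y) * ennreal ((y - S y)\<^sup>2) \<partial>std_normal)
        \<le> ennreal (2 * (\<integral>y. f y * ln (f y) \<partial>std_normal))"
      unfolding transport_ineq_def S_eq using nonneg by (simp add: ennreal_mult)
    then have "(\<integral>\<^sup>+y. ennreal (h y) * ennreal ((y - S y)\<^sup>2) \<partial>std_normal)
        \<le> ennreal c * ennreal (2 * (\<integral>y. f y * ln (f y) \<partial>std_normal))"
      by (subst scale) (auto simp: S_eq intro: mult_left_mono)
    also have "\<dots> = ennreal (2 * ((\<integral>y. h y * ln (h y) \<partial>std_normal) - c * ln c))"
      using c 1 unfolding ent_f by (subst ennreal_mult[symmetric]) auto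
    finally have 2: "(\<integral>\<^sup>+y. ennreal (h y) * ennreal ((y - S y)\<^sup>2) \<partial>std_normal) \<le> \<dots>" .
    have 3: "(\<integral>\<^sup>+y. ennreal (h y) * u (S y) \<partial>std_normal) = ennreal c * (\<integral>\<^sup>+y. u y \<partial>std_normal)"
      if [measurable]: "u \<in> borel_measurable borel"
    proof -
      have "(\<integral>\<^sup>+y. ennreal (h y) * u (S y) \<partial>std_normal) = ennreal c * (\<integral>\<^sup>+y. ennreal (f y) * u (S y) \<partial>std_normal)"
        by (rule scale) (simp add: S_eq)
      also have "(\<integral>\<^sup>+y. ennreal (f y) * u (S y) \<partial>std_normal) = (\<integral>\<^sup>+y. u (S y) \<partial>N)"
        by (subst nn_integral_density) (auto simp: S_eq)
      also have "\<dots> = (\<integral>\<^sup>+y. u y \<partial>distr N borel S)"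
        by (subst nn_integral_distr) (auto simp: S_eq)
      also have "\<dots> = (\<integral>\<^sup>+y. u y \<partial>std_normal)"
        unfolding S_eq distr_transport_map ..
      finally show ?thesis .
    qed
    show ?thesis using 1 2 3 by blast
  qed
  then show "c * ln c \<le> (\<integral>y. h y * ln (h y) \<partial>std_normal)"
    "(\<integral>\<^sup>+y. ennreal (h y) * ennreal ((y - S y)\<^sup>2) \<partial>std_normal)
      \<le> ennreal (2 * ((\<integral>y. h y * ln (h y) \<partial>std_normal) - c * ln c))"
    "u \<in> borel_measurable borel \<Longrightarrow>
      (\<integral>\<^sup>+y. ennreal (h y) * u (S y) \<partial>std_normal) = ennreal c * (\<integral>\<^sup>+y. u y \<partial>std_normal)"
    by blast+
qed

text \<open>Joint measurability in base point and fibre variable makes the triangular map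
  measurable. The indicator of \<open>{..y}\<close> is written as a comparison, which is jointly
  measurable in \<open>t\<close> and \<open>y\<close>.\<close>

lemma measurable_transport_map_parametric:
  assumes [measurable]: "case_prod f \<in> borel_measurable (M \<Otimes>\<^sub>M borel)"
  shows "(\<lambda>(x, y). transport_map (f x) y) \<in> borel_measurable (M \<Otimes>\<^sub>M borel)"
proof -
  have "(\<lambda>(x, y). \<integral>t. f x t * (if t \<le> y then 1 else 0) \<partial>std_normal) \<in> borel_measurable (M \<Otimes>\<^sub>M borel)"
    by measurable
  then have "(\<lambda>p. quantile (case p of (x, y) \<Rightarrow> \<integral>t. f x t * (if t \<le> y then 1 else 0) \<partial>std_normal))
      \<in> borel_measurable (M \<Otimes>\<^sub>M borel)"
    by measurable
  also have "(\<lambda>p. quantile (case p of (x, y) \<Rightarrow> \<integral>t. f x t * (if t \<le> y then 1 else 0) \<partial>std_normal)) =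
      (\<lambda>(x, y). transport_map (f x) y)"
    by (auto simp: transport_map_def fun_eq_iff indicator_def of_bool_def)
  finally show ?thesis .
qed

text \<open>Demanding a transport map instead of a coupling lets the tensorization avoid disintegrations.\<close>

definition map_transport_ineq :: "'a measure \<Rightarrow> ('a \<Rightarrow> 'a \<Rightarrow> ennreal) \<Rightarrow> bool" where
  "map_transport_ineq M c \<longleftrightarrow> case_prod c \<in> borel_measurable (M \<Otimes>\<^sub>M M) \<and> (\<forall>f::'a \<Rightarrow> real. integrable M f \<longrightarrow> (\<forall>x. 0 \<le> f x) \<longrightarrow>
     (\<integral>x. f x \<partial>M) = 1 \<longrightarrow> integrable M (\<lambda>x. f x * ln (f x)) \<longrightarrow>
     (\<exists>S\<in>measurable M M. distr (density M f) M S = M \<and>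
        (\<integral>\<^sup>+x. ennreal (f x) * c x (S x) \<partial>M) \<le> ennreal (2 * (\<integral>x. f x * ln (f x) \<partial>M))))"

lemma map_transport_ineqD:
  assumes "map_transport_ineq M c" "integrable M f" "\<And>x. 0 \<le> f x" "(\<integral>x. f x \<partial>M) = (1::real)"
    "integrable M (\<lambda>x. f x * ln (f x))"
  obtains S where "S \<in> measurable M M" "distr (density M f) M S = M"
    "(\<integral>\<^sup>+x. ennreal (f x) * c x (S x) \<partial>M) \<le> ennreal (2 * (\<integral>x. f x * ln (f x) \<partial>M))"
  using assms unfolding map_transport_ineq_def by blast

text \<open>Conjugating a transport map by \<open>\<phi>\<close> gives one for the image measure,
  since entropy is unchanged when a density is pulled back along \<open>\<phi>\<close>. It serves to
  append a coordinate, to pass from tuples to vectors, and to reach \<mu> from the Gaussian.\<close>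

lemma map_transport_ineq_distr:
  assumes ineq: "map_transport_ineq M c"
    and \<phi>[measurable]: "\<phi> \<in> measurable M L" and \<phi>'[measurable]: "\<phi>' \<in> measurable L M"
    and inv: "\<And>x. x \<in> space M \<Longrightarrow> \<phi>' (\<phi> x) = x"
  shows "map_transport_ineq (distr M L \<phi>) (\<lambda>x y. c (\<phi>' x) (\<phi>' y))"
  unfolding map_transport_ineq_def
proof (intro allI impI conjI)
  have [measurable]: "case_prod c \<in> borel_measurable (M \<Otimes>\<^sub>M M)"
    using ineq by (simp add: map_transport_ineq_def)
  then show "case_prod (\<lambda>x y. c (\<phi>' x) (\<phi>' y)) \<in> borel_measurable (distr M L \<phi> \<Otimes>\<^sub>M distr M L \<phi>)"
    by measurable
  let ?N = "distr M L \<phi>"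
  fix f :: "_ \<Rightarrow> real"
  assume int: "integrable ?N f" and nonneg: "\<forall>x. 0 \<le> f x" and mass: "(\<integral>x. f x \<partial>?N) = 1"
    and ent: "integrable ?N (\<lambda>x. f x * ln (f x))"
  have fm[measurable]: "f \<in> borel_measurable L" using borel_measurable_integrable[OF int] by simp
  obtain S where S[measurable]: "S \<in> measurable M M"
    and push: "distr (density M (\<lambda>x. ennreal (f (\<phi> x)))) M S = M"
    and cost: "(\<integral>\<^sup>+x. ennreal (f (\<phi> x)) * c x (S x) \<partial>M) \<le> ennreal (2 * (\<integral>x. f (\<phi> x) * ln (f (\<phi> x)) \<partial>M))"
  proof (rule map_transport_ineqD[OF ineq, of "\<lambda>x. f (\<phi> x)"])
    show "integrable M (\<lambda>x. f (\<phi> x))" using int by (subst (asm) integrable_distr_eq) auto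
    show "integrable M (\<lambda>x. f (\<phi> x) * ln (f (\<phi> x)))" using ent by (subst (asm) integrable_distr_eq) auto
    show "(\<integral>x. f (\<phi> x) \<partial>M) = 1" using mass by (subst (asm) integral_distr) auto
  qed (use nonneg in auto)
  show "\<exists>S\<in>measurable ?N ?N. distr (density ?N f) ?N S = ?N \<and>
      (\<integral>\<^sup>+x. ennreal (f x) * c (\<phi>' x) (\<phi>' (S x)) \<partial>?N) \<le> ennreal (2 * (\<integral>x. f x * ln (f x) \<partial>?N))"
  proof (intro bexI conjI)
    let ?S = "\<lambda>x. \<phi> (S (\<phi>' x))"
    show "?S \<in> measurable ?N ?N" by simp
    have "density ?N f = distr (density M (\<lambda>x. ennreal (f (\<phi> x)))) L \<phi>"
      by (rule density_distr) auto
    then have "distr (density ?N f) ?N ?S = distr (density M (\<lambda>x. ennreal (f (\<phi> x)))) ?N (?S \<circ> \<phi>)"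
      by (simp add: distr_distr)
    also have "\<dots> = distr (density M (\<lambda>x. ennreal (f (\<phi> x)))) L (\<phi> \<circ> S)"
      by (rule distr_cong) (auto simp: inv)
    also have "\<dots> = distr (distr (density M (\<lambda>x. ennreal (f (\<phi> x)))) M S) L \<phi>"
      by (simp add: distr_distr)
    also have "\<dots> = ?N" unfolding push ..
    finally show "distr (density ?N f) ?N ?S = ?N" .
    have "(\<integral>\<^sup>+x. ennreal (f x) * c (\<phi>' x) (\<phi>' (?S x)) \<partial>?N) = (\<integral>\<^sup>+x. ennreal (f (\<phi> x)) * c x (S x) \<partial>M)"
      by (subst nn_integral_distr) (auto simp: inv measurable_space[OF S] intro!: nn_integral_cong)
    also note cost
    also have "(\<integral>x. f (\<phi> x) * ln (f (\<phi> x)) \<partial>M) = (\<integral>x. f x * ln (f x) \<partial>?N)"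
      by (subst integral_distr) auto
    finally show "(\<integral>\<^sup>+x. ennreal (f x) * c (\<phi>' x) (\<phi>' (?S x)) \<partial>?N) \<le>
        ennreal (2 * (\<integral>x. f x * ln (f x) \<partial>?N))" .
  qed
qed

text \<open>Transport the first marginal, then each conditional law, and add up by the chain rule for entropy.\<close>

lemma map_transport_ineq_pair:
  assumes "prob_space M" and ineq: "map_transport_ineq M c"
  shows "map_transport_ineq (M \<Otimes>\<^sub>M std_normal)
    (\<lambda>p q. c (fst p) (fst q) + ennreal ((snd p - snd q)\<^sup>2))"
  unfolding map_transport_ineq_def
proof (intro allI impI conjI)
  interpret M: prob_space M by fact
  interpret P: pair_prob_space M std_normal ..
  have c[measurable]: "case_prod c \<in> borel_measurable (M \<Otimes>\<^sub>M M)"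
    using ineq by (simp add: map_transport_ineq_def)
  let ?P = "M \<Otimes>\<^sub>M std_normal"
  show "(\<lambda>(p, q). c (fst p) (fst q) + ennreal ((snd p - snd q)\<^sup>2)) \<in> borel_measurable (?P \<Otimes>\<^sub>M ?P)"
    by measurable
  fix f :: "'a \<times> real \<Rightarrow> real"
  assume int: "integrable ?P f" and "\<forall>x. 0 \<le> f x" and mass: "(\<integral>x. f x \<partial>?P) = 1"
    and ent: "integrable ?P (\<lambda>x. f x * ln (f x))"
  then have nonneg: "0 \<le> f p" for p by blast
  have fm[measurable]: "f \<in> borel_measurable (M \<Otimes>\<^sub>M borel)"
    using borel_measurable_integrable[OF int] by (simp cong: measurable_cong_sets sets_pair_measure_cong)
  define f1 where "f1 x = (\<integral>y. f (x, y) \<partial>std_normal)" for x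
  define H where "H x = (\<integral>y. f (x, y) * ln (f (x, y)) \<partial>std_normal)" for x
  define T where "T x y = transport_map (\<lambda>y. f (x, y) / f1 x) y" for x y
  have [measurable]: "f1 \<in> borel_measurable M" "H \<in> borel_measurable M"
    unfolding f1_def[abs_def] H_def[abs_def] by measurable
  have [measurable]: "(\<lambda>p. T (fst p) (snd p)) \<in> borel_measurable (M \<Otimes>\<^sub>M borel)"
    using measurable_transport_map_parametric[of "\<lambda>x y. f (x, y) / f1 x" M]
    by (simp add: T_def case_prod_beta' measurable_split_conv)
  have f1_nonneg: "0 \<le> f1 x" for x
    unfolding f1_def using nonneg by (intro integral_nonneg_AE) auto
  have int_f1: "integrable M f1"
    unfolding f1_def[abs_def] by (rule P.integrable_fst'[OF int])
  have mass_f1: "(\<integral>x. f1 x \<partial>M) = 1"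
    unfolding f1_def using P.integral_fst'[OF int] mass by simp
  have int_H: "integrable M H"
    unfolding H_def[abs_def] by (rule P.integrable_fst'[OF ent])
  have integral_H: "(\<integral>x. H x \<partial>M) = (\<integral>p. f p * ln (f p) \<partial>?P)"
    unfolding H_def by (rule P.integral_fst'[OF ent])
  have fibre: "AE x in M. integrable std_normal (\<lambda>y. f (x, y)) \<and> integrable std_normal (\<lambda>y. f (x, y) * ln (f (x, y)))"
    using P.AE_integrable_fst'[OF int] P.AE_integrable_fst'[OF ent] by eventually_elim simp
  have f1_ln_le: "AE x in M. f1 x * ln (f1 x) \<le> H x"
    using fibre unfolding f1_def H_def
    by eventually_elim (rule transport_map_scaled(1), auto simp: nonneg)
  \<comment> \<open>The marginal entropy is squeezed between \<open>f1 x - 1\<close> and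
    \<open>H x\<close>, the upper bound being Jensen's inequality in the fibre.\<close>
  have int_f1_ln: "integrable M (\<lambda>x. f1 x * ln (f1 x))"
  proof (rule Bochner_Integration.integrable_bound)
    show "integrable M (\<lambda>x. \<bar>H x\<bar> + 1)" using int_H by simp
    show "AE x in M. norm (f1 x * ln (f1 x)) \<le> norm (\<bar>H x\<bar> + 1)"
      using f1_ln_le
    proof eventually_elim
      case (elim x)
      then show ?case using mult_ln_ge[OF f1_nonneg[of x]] f1_nonneg[of x] unfolding real_norm_def by linarith
    qed
  qed measurable
  obtain S where S[measurable]: "S \<in> measurable M M" and push: "distr (density M f1) M S = M"
    and cost: "(\<integral>\<^sup>+x. ennreal (f1 x) * c x (S x) \<partial>M) \<le> ennreal (2 * (\<integral>x. f1 x * ln (f1 x) \<partial>M))"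
    using map_transport_ineqD[OF ineq int_f1 f1_nonneg mass_f1 int_f1_ln] by blast
  define R where "R p = (S (fst p), T (fst p) (snd p))" for p
  have R[measurable]: "R \<in> measurable ?P ?P"
    unfolding R_def[abs_def] by measurable
  show "\<exists>S\<in>measurable ?P ?P. distr (density ?P f) ?P S = ?P \<and>
      (\<integral>\<^sup>+x. ennreal (f x) * (c (fst x) (fst (S x)) + ennreal ((snd x - snd (S x))\<^sup>2)) \<partial>?P)
        \<le> ennreal (2 * (\<integral>x. f x * ln (f x) \<partial>?P))"
  proof (intro bexI[OF _ R] conjI)
    show "distr (density ?P f) ?P R = ?P"
    proof (rule measure_eqI)
      fix A assume "A \<in> sets (distr (density ?P f) ?P R)"
      then have A[measurable]: "A \<in> sets ?P" by simp
      have "emeasure (distr (density ?P f) ?P R) A = (\<integral>\<^sup>+p. indicator A p \<partial>distr (density ?P f) ?P R)"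
        by (rule nn_integral_indicator[symmetric]) (use A in \<open>simp only: sets_distr\<close>)
      also have "\<dots> = (\<integral>\<^sup>+p. ennreal (f p) * indicator A (R p) \<partial>?P)"
        by (simp add: nn_integral_distr nn_integral_density)
      also have "\<dots> = (\<integral>\<^sup>+x. \<integral>\<^sup>+y. ennreal (f (x, y)) * indicator A (R (x, y)) \<partial>std_normal \<partial>M)"
        by (subst std_normal.nn_integral_fst[symmetric]) auto
      \<comment> \<open>The fibre map turns the conditional mass over \<open>x\<close> into
        \<open>f1 x\<close> times the normal law; only the push-forward of the marginal under
        \<open>S\<close> remains.\<close>
      also have "\<dots> = (\<integral>\<^sup>+x. ennreal (f1 x) * (\<integral>\<^sup>+y. indicator A (S x, y) \<partial>std_normal) \<partial>M)"
      proof (rule nn_integral_cong_AE)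
        show "AE x in M. (\<integral>\<^sup>+y. ennreal (f (x, y)) * indicator A (R (x, y)) \<partial>std_normal) =
            ennreal (f1 x) * (\<integral>\<^sup>+y. indicator A (S x, y) \<partial>std_normal)"
          using fibre AE_space
        proof eventually_elim
          case (elim x)
          then have "S x \<in> space M" using measurable_space[OF S] by simp
          then have [measurable]: "(\<lambda>y. indicator A (S x, y) :: ennreal) \<in> borel_measurable borel"
            by measurable
          show ?case
            using transport_map_scaled(3)[of "\<lambda>y. f (x, y)" "\<lambda>y. indicator A (S x, y)"] elim nonneg
            by (simp add: R_def T_def f1_def)
        qed
      qed
      also have "\<dots> = (\<integral>\<^sup>+x. (\<integral>\<^sup>+y. indicator A (x, y) \<partial>std_normal) \<partial>distr (density M f1) M S)"
        by (simp add: nn_integral_distr nn_integral_density)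
      also have "\<dots> = (\<integral>\<^sup>+p. indicator A p \<partial>?P)"
        unfolding push by (rule std_normal.nn_integral_fst) simp
      also have "\<dots> = emeasure ?P A"
        by (rule nn_integral_indicator[OF A])
      finally show "emeasure (distr (density ?P f) ?P R) A = emeasure ?P A" .
    qed simp
    have "(\<integral>\<^sup>+p. ennreal (f p) * (c (fst p) (fst (R p)) + ennreal ((snd p - snd (R p))\<^sup>2)) \<partial>?P) =
        (\<integral>\<^sup>+p. ennreal (f p) * c (fst p) (S (fst p)) + ennreal (f p) * ennreal ((snd p - T (fst p) (snd p))\<^sup>2) \<partial>?P)"
      by (simp add: R_def distrib_left)
    also have "\<dots> = (\<integral>\<^sup>+p. ennreal (f p) * c (fst p) (S (fst p)) \<partial>?P) +
        (\<integral>\<^sup>+p. ennreal (f p) * ennreal ((snd p - T (fst p) (snd p))\<^sup>2) \<partial>?P)"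
      by (rule nn_integral_add) measurable
    also have "(\<integral>\<^sup>+p. ennreal (f p) * c (fst p) (S (fst p)) \<partial>?P) =
        (\<integral>\<^sup>+x. \<integral>\<^sup>+y. ennreal (f (x, y)) * c x (S x) \<partial>std_normal \<partial>M)"
      by (subst std_normal.nn_integral_fst[symmetric]) auto
    also have "\<dots> = (\<integral>\<^sup>+x. ennreal (f1 x) * c x (S x) \<partial>M)"
    proof (rule nn_integral_cong_AE)
      show "AE x in M. (\<integral>\<^sup>+y. ennreal (f (x, y)) * c x (S x) \<partial>std_normal) = ennreal (f1 x) * c x (S x)"
        using fibre AE_space
      proof eventually_elim
        case (elim x)
        then have [measurable]: "(\<lambda>y. f (x, y)) \<in> borel_measurable borel" by simp
        have "(\<integral>\<^sup>+y. ennreal (f (x, y)) * c x (S x) \<partial>std_normal) =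
            (\<integral>\<^sup>+y. ennreal (f (x, y)) \<partial>std_normal) * c x (S x)"
          by (rule nn_integral_multc) simp
        also have "(\<integral>\<^sup>+y. ennreal (f (x, y)) \<partial>std_normal) = ennreal (f1 x)"
          unfolding f1_def using elim nonneg by (intro nn_integral_eq_integral) auto
        finally show ?case .
      qed
    qed
    also note cost
    also have "(\<integral>\<^sup>+p. ennreal (f p) * ennreal ((snd p - T (fst p) (snd p))\<^sup>2) \<partial>?P) =
        (\<integral>\<^sup>+x. \<integral>\<^sup>+y. ennreal (f (x, y)) * ennreal ((y - T x y)\<^sup>2) \<partial>std_normal \<partial>M)"
      by (subst std_normal.nn_integral_fst[symmetric]) auto
    \<comment> \<open>The integrand is twice the entropy of the unnormalized conditional law. The
      term subtracted here is restored by the bound for the marginal cost, which is the chain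
      rule.\<close>
    also have "\<dots> \<le> (\<integral>\<^sup>+x. ennreal (2 * (H x - f1 x * ln (f1 x))) \<partial>M)"
    proof (rule nn_integral_mono_AE)
      show "AE x in M. (\<integral>\<^sup>+y. ennreal (f (x, y)) * ennreal ((y - T x y)\<^sup>2) \<partial>std_normal)
          \<le> ennreal (2 * (H x - f1 x * ln (f1 x)))"
        using fibre unfolding f1_def H_def T_def
        by eventually_elim (rule transport_map_scaled(2), auto simp: nonneg)
    qed
    also have "\<dots> = ennreal (\<integral>x. 2 * (H x - f1 x * ln (f1 x)) \<partial>M)"
      using f1_ln_le int_H int_f1_ln by (intro nn_integral_eq_integral) auto
    also have "ennreal (2 * (\<integral>x. f1 x * ln (f1 x) \<partial>M)) + \<dots> =
        ennreal (2 * (\<integral>x. f1 x * ln (f1 x) \<partial>M) + (\<integral>x. 2 * (H x - f1 x * ln (f1 x)) \<partial>M))"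
    proof (rule ennreal_plus[symmetric])
      show "0 \<le> 2 * (\<integral>x. f1 x * ln (f1 x) \<partial>M)"
        using M.entropy_nonneg[OF int_f1 f1_nonneg mass_f1 int_f1_ln] by simp
      show "0 \<le> (\<integral>x. 2 * (H x - f1 x * ln (f1 x)) \<partial>M)"
        using f1_ln_le by (intro integral_nonneg_AE) (auto elim: eventually_mono)
    qed
    also have "2 * (\<integral>x. f1 x * ln (f1 x) \<partial>M) + (\<integral>x. 2 * (H x - f1 x * ln (f1 x)) \<partial>M) =
        2 * (\<integral>p. f p * ln (f p) \<partial>?P)"
      using int_H int_f1_ln integral_H by simp
    finally show "(\<integral>\<^sup>+p. ennreal (f p) * (c (fst p) (fst (R p)) + ennreal ((snd p - snd (R p))\<^sup>2)) \<partial>?P)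
        \<le> ennreal (2 * (\<integral>p. f p * ln (f p) \<partial>?P))"
      by (simp add: add_mono)
  qed
qed

text \<open>Induction on the index set: the new coordinate enters as a pair product with the normal
  law, \<open>\<phi>\<close> inserts it into the tuple and \<open>\<phi>'\<close> takes it
  out.\<close>

lemma map_transport_ineq_PiM:
  assumes "finite I"
  shows "map_transport_ineq (\<Pi>\<^sub>M i\<in>I. std_normal) (\<lambda>x y. ennreal (\<Sum>i\<in>I. (x i - y i)\<^sup>2))"
  using assms
proof (induction I)
  case empty
  let ?M = "\<Pi>\<^sub>M i\<in>{}. std_normal"
  show ?case
    unfolding map_transport_ineq_def
  proof (intro conjI allI impI)
    fix f :: "(_ \<Rightarrow> real) \<Rightarrow> real"
    assume "(\<integral>x. f x \<partial>?M) = 1"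
    \<comment> \<open>The empty product is a point mass, so the density is \<open>1\<close> and the
      identity transports at no cost.\<close>
    then have "f (\<lambda>_. undefined) = 1"
      by (simp add: PiM_empty lebesgue_integral_count_space_finite)
    then have "density ?M f = density ?M (\<lambda>_. 1)"
      by (intro density_cong) (auto simp: PiM_empty)
    then have "density ?M f = ?M" by (simp add: density_1)
    then show "\<exists>S\<in>measurable ?M ?M. distr (density ?M f) ?M S = ?M \<and>
       (\<integral>\<^sup>+x. ennreal (f x) * ennreal (\<Sum>i\<in>{}. (x i - S x i)\<^sup>2) \<partial>?M) \<le> ennreal (2 * (\<integral>x. f x * ln (f x) \<partial>?M))"
      by (intro bexI[of _ "\<lambda>x. x"]) (auto simp: distr_id[unfolded id_def])
  qed simp
next
  case (insert i I)
  let ?M = "\<lambda>J. \<Pi>\<^sub>M i\<in>J. std_normal"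
  interpret product_prob_space "\<lambda>_. std_normal" ..
  have "prob_space (?M I)" by (intro prob_space_PiM) (rule std_normal.prob_space_axioms)
  then interpret I: prob_space "?M I" .
  define \<phi> where "\<phi> p = (fst p)(i := snd p)" for p :: "(_ \<Rightarrow> real) \<times> real"
  define \<phi>' where "\<phi>' x = (restrict x I, x i)" for x :: "_ \<Rightarrow> real"
  have \<phi>[measurable]: "\<phi> \<in> measurable (?M I \<Otimes>\<^sub>M std_normal) (?M (insert i I))"
    unfolding \<phi>_def[abs_def] by (rule measurable_fun_upd[where J = I]) auto
  have \<phi>'[measurable]: "\<phi>' \<in> measurable (?M (insert i I)) (?M I \<Otimes>\<^sub>M std_normal)"
    unfolding \<phi>'_def[abs_def]
    by (intro measurable_Pair measurable_restrict_subset measurable_component_singleton) auto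
  have eq: "distr (?M I \<Otimes>\<^sub>M std_normal) (?M (insert i I)) \<phi> = ?M (insert i I)"
  proof (rule measure_eqI)
    fix A assume "A \<in> sets (distr (?M I \<Otimes>\<^sub>M std_normal) (?M (insert i I)) \<phi>)"
    then have A: "A \<in> sets (?M (insert i I))" by simp
    then have Am: "indicator A \<in> borel_measurable (?M (insert i I))" by simp
    have "emeasure (distr (?M I \<Otimes>\<^sub>M std_normal) (?M (insert i I)) \<phi>) A =
        (\<integral>\<^sup>+p. indicator A p \<partial>distr (?M I \<Otimes>\<^sub>M std_normal) (?M (insert i I)) \<phi>)"
      using A by (intro nn_integral_indicator[symmetric]) simp
    also have "\<dots> = (\<integral>\<^sup>+p. indicator A (\<phi> p) \<partial>(?M I \<Otimes>\<^sub>M std_normal))"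
      by (rule nn_integral_distr[OF \<phi>]) (use Am in simp)
    also have "\<dots> = (\<integral>\<^sup>+x. \<integral>\<^sup>+y. indicator A (\<phi> (x, y)) \<partial>std_normal \<partial>?M I)"
      by (rule std_normal.nn_integral_fst[symmetric]) (rule measurable_compose[OF \<phi> Am])
    also have "\<dots> = (\<integral>\<^sup>+x. indicator A x \<partial>?M (insert i I))"
      using product_nn_integral_insert[OF insert.hyps Am] by (simp add: \<phi>_def)
    also have "\<dots> = emeasure (?M (insert i I)) A"
      by (rule nn_integral_indicator[OF A])
    finally show "emeasure (distr (?M I \<Otimes>\<^sub>M std_normal) (?M (insert i I)) \<phi>) A = emeasure (?M (insert i I)) A" .
  qed simp
  have inv: "\<phi>' (\<phi> p) = p" if "p \<in> space (?M I \<Otimes>\<^sub>M std_normal)" for p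
    using that insert.hyps
    by (auto simp: \<phi>_def \<phi>'_def space_pair_measure space_PiM PiE_def extensional_def fun_eq_iff)
  have cost: "ennreal (\<Sum>j\<in>I. (fst (\<phi>' x) j - fst (\<phi>' y) j)\<^sup>2) + ennreal ((snd (\<phi>' x) - snd (\<phi>' y))\<^sup>2) =
      ennreal (\<Sum>j\<in>insert i I. (x j - y j)\<^sup>2)" for x y
    using insert.hyps by (subst ennreal_plus[symmetric]) (auto simp: \<phi>'_def sum_nonneg add.commute)
  show ?case
    using map_transport_ineq_distr[OF map_transport_ineq_pair[OF I.prob_space_axioms insert.IH] \<phi> \<phi>'] inv
    unfolding cost eq by blast
qed

text \<open>Lebesgue measure is the image of the product measure under expansion in the basis, and
  the Gaussian density factorizes because the squared norm is the sum of squared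
  coordinates.\<close>

lemma standard_gaussian_eq_distr:
  "standard_gaussian = distr (\<Pi>\<^sub>M b\<in>Basis. std_normal) borel (\<lambda>x. \<Sum>b\<in>Basis. x b *\<^sub>R b :: 'a::euclidean_space)"
proof -
  let ?\<phi> = "\<lambda>x. \<Sum>b\<in>Basis. x b *\<^sub>R b :: 'a"
  let ?g = "\<lambda>x::'a. ennreal (exp (- (norm x)\<^sup>2 / 2) / (2 * pi) powr (real DIM('a) / 2))"
  interpret lborel: product_sigma_finite "\<lambda>_::'a. lborel :: real measure" ..
  interpret product_prob_space "\<lambda>_::'a. std_normal" ..
  have \<phi>[measurable]: "?\<phi> \<in> measurable (\<Pi>\<^sub>M b\<in>Basis. lborel) borel" by measurable
  have g: "?g (?\<phi> x) = (\<Prod>b\<in>Basis. ennreal (std_normal_density (x b)))" for x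
  proof -
    have "(norm (?\<phi> x))\<^sup>2 = (\<Sum>b\<in>Basis. (x b)\<^sup>2)"
      unfolding power2_norm_eq_inner euclidean_inner[of "?\<phi> x" "?\<phi> x"]
      by (simp add: power2_eq_square)
    then have "exp (- (norm (?\<phi> x))\<^sup>2 / 2) = (\<Prod>b\<in>Basis. exp (- (x b)\<^sup>2 / 2))"
      by (simp add: exp_sum[symmetric] sum_negf sum_divide_distrib)
    moreover have "(2 * pi) powr (real DIM('a) / 2) = sqrt (2 * pi) ^ DIM('a)"
      by (simp add: powr_half_sqrt[symmetric] powr_realpow[symmetric] powr_powr)
    ultimately have "exp (- (norm (?\<phi> x))\<^sup>2 / 2) / (2 * pi) powr (real DIM('a) / 2) =
        (\<Prod>b\<in>Basis. std_normal_density (x b))"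
      by (simp add: std_normal_density_def prod_dividef)
    then show ?thesis by (simp add: prod_ennreal)
  qed
  have "density (\<Pi>\<^sub>M b\<in>(Basis::'a set). lborel) (\<lambda>x. ?g (?\<phi> x)) = (\<Pi>\<^sub>M b\<in>Basis. std_normal)"
  proof (rule PiM_eqI)
    show "sets (density (\<Pi>\<^sub>M b\<in>(Basis::'a set). lborel) (\<lambda>x. ?g (?\<phi> x))) = sets (\<Pi>\<^sub>M b\<in>Basis. std_normal)"
      by (simp cong: sets_PiM_cong)
    fix A :: "'a \<Rightarrow> real set" assume A: "\<And>b. b \<in> Basis \<Longrightarrow> A b \<in> sets std_normal"
    then have [measurable]: "A b \<in> sets borel" if "b \<in> Basis" for b using that by simp
    have "emeasure (density (\<Pi>\<^sub>M b\<in>(Basis::'a set). lborel) (\<lambda>x. ?g (?\<phi> x))) (Pi\<^sub>E Basis A) =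
        (\<integral>\<^sup>+x. ?g (?\<phi> x) * indicator (Pi\<^sub>E Basis A) x \<partial>(\<Pi>\<^sub>M b\<in>(Basis::'a set). lborel))"
      by (rule emeasure_density) (auto intro!: sets_PiM_I_finite)
    also have "\<dots> = (\<integral>\<^sup>+x. (\<Prod>b\<in>Basis. ennreal (std_normal_density (x b)) * indicator (A b) (x b)) \<partial>(\<Pi>\<^sub>M b\<in>(Basis::'a set). lborel))"
      unfolding g by (intro nn_integral_cong) (auto simp: indicator_def space_PiM PiE_def Pi_def prod.distrib)
    also have "\<dots> = (\<Prod>b\<in>Basis. \<integral>\<^sup>+y. ennreal (std_normal_density y) * indicator (A b) y \<partial>lborel)"
      by (rule lborel.product_nn_integral_prod) auto
    also have "\<dots> = (\<Prod>b\<in>Basis. emeasure std_normal (A b))"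
      by (intro prod.cong refl emeasure_density[symmetric]) auto
    finally show "emeasure (density (\<Pi>\<^sub>M b\<in>(Basis::'a set). lborel) (\<lambda>x. ?g (?\<phi> x))) (Pi\<^sub>E Basis A) = \<dots>" .
  qed simp
  then have "distr (\<Pi>\<^sub>M b\<in>Basis. std_normal) borel ?\<phi> =
      distr (density (\<Pi>\<^sub>M b\<in>Basis. lborel) (\<lambda>x. ?g (?\<phi> x))) borel ?\<phi>" by simp
  also have "\<dots> = density (distr (\<Pi>\<^sub>M b\<in>Basis. lborel) borel ?\<phi>) ?g"
    by (rule density_distr[symmetric]) auto
  also have "\<dots> = standard_gaussian"
    unfolding standard_gaussian_def by (subst (2) lborel_eq) simp
  finally show ?thesis ..
qed

theorem map_transport_ineq_standard_gaussian:
  "map_transport_ineq (standard_gaussian :: 'a::euclidean_space measure) (\<lambda>x y. ennreal ((norm (x - y))\<^sup>2))"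
proof -
  \<comment> \<open>Points of the product space are \<open>undefined\<close> off
    \<open>Basis\<close>, so the coordinate map has to be restricted.\<close>
  have sq: "(\<Sum>b\<in>Basis. (restrict (\<lambda>b. x \<bullet> b) Basis b - restrict (\<lambda>b. y \<bullet> b) Basis b)\<^sup>2) = (norm (x - y))\<^sup>2" for x y :: 'a
    unfolding power2_norm_eq_inner euclidean_inner[of "x - y" "x - y"]
    by (simp add: power2_eq_square inner_diff_left)
  have "map_transport_ineq (distr (\<Pi>\<^sub>M b\<in>Basis. std_normal) borel (\<lambda>x. \<Sum>b\<in>Basis. x b *\<^sub>R b :: 'a))
     (\<lambda>x y. ennreal (\<Sum>b\<in>Basis. (restrict (\<lambda>b. x \<bullet> b) Basis b - restrict (\<lambda>b. y \<bullet> b) Basis b)\<^sup>2))"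
  proof (rule map_transport_ineq_distr[OF map_transport_ineq_PiM[OF finite_Basis]])
    show "(\<lambda>x::'a. restrict (\<lambda>b. x \<bullet> b) Basis) \<in> measurable borel (\<Pi>\<^sub>M b\<in>Basis. std_normal)"
      by (rule measurable_restrict) simp
    show "restrict (\<lambda>b. (\<Sum>b\<in>Basis. x b *\<^sub>R b) \<bullet> b) Basis = x"
      if "x \<in> space (\<Pi>\<^sub>M b\<in>(Basis::'a set). std_normal)" for x
      using that by (auto simp: space_PiM PiE_def extensional_def fun_eq_iff)
  qed measurable
  then show ?thesis
    unfolding sq standard_gaussian_eq_distr .
qed

subsection \<open>Transfer to the manifold\<close>

lemma space_borel_of: "space (borel_of E) = topspace E"
  unfolding borel_of_def by (rule space_measure_of) (auto dest: openin_subset)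

lemma measurable_continuous_map_borel_of:
  assumes "continuous_map E euclidean f"
  shows "f \<in> measurable (borel_of E) borel"
proof (rule borel_measurableI)
  fix U :: "'b set" assume "open U"
  then have "openin E {x \<in> topspace E. f x \<in> U}"
    using assms by (simp add: continuous_map_def)
  moreover have "space (borel_of E) = topspace E"
    by (rule space_borel_of)
  moreover have "f -` U \<inter> topspace E = {x \<in> topspace E. f x \<in> U}" by auto
  moreover have "sets (borel_of E) = sigma_sets (topspace E) {U. openin E U}"
    by (auto simp: borel_of_def intro!: sets_measure_of dest: openin_subset)
  ultimately show "f -` U \<inter> space (borel_of E) \<in> sets (borel_of E)"
    by (auto intro: sigma_sets.Basic)
qed

lemma measurable_borel_of_continuous_map:
  assumes "continuous_map euclidean E f"
  shows "f \<in> measurable borel (borel_of E)"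
  unfolding borel_of_def
proof (rule measurable_measure_of)
  show "{U. openin E U} \<subseteq> Pow (topspace E)" by (auto dest: openin_subset)
  show "f \<in> space borel \<rightarrow> topspace E" using assms by (auto simp: continuous_map_def)
  show "f -` U \<inter> space borel \<in> sets borel" if "U \<in> {U. openin E U}" for U
    using that assms by (auto simp: continuous_map_def vimage_def open_openin[symmetric])
qed

lemma ennreal_powr_mono:
  assumes "0 \<le> a" "x \<le> y"
  shows "ennreal_powr x a \<le> ennreal_powr y a"
  using assms by (auto simp: ennreal_powr_def top_unique less_top
      intro!: ennreal_leI powr_mono2 enn2real_mono)

text \<open>The law of \<open>(\<psi> x, \<psi> (S x))\<close> under \<open>M\<close> is a coupling
  of the two image measures.\<close>

lemma psi_wasserstein_le_map:
  fixes \<psi> :: "'e \<Rightarrow> 'a::euclidean_space"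
  assumes \<psi>[measurable]: "\<psi> \<in> borel_measurable M"
    and S[measurable]: "S \<in> measurable M M" and "sets N = sets M"
    and push: "distr M N S = N"
  shows "psi_wasserstein 2 \<psi> M N \<le> ennreal_powr (\<integral>\<^sup>+x. ennreal ((norm (\<psi> x - \<psi> (S x)))\<^sup>2) \<partial>M) (1 / 2)"
proof -
  have [measurable]: "\<psi> \<in> borel_measurable N" "S \<in> measurable M N"
    using \<psi> S \<open>sets N = sets M\<close> by (simp_all cong: measurable_cong_sets)
  let ?\<pi> = "distr M (borel \<Otimes>\<^sub>M borel) (\<lambda>x. (\<psi> x, \<psi> (S x)))"
  have "distr (distr M N S) borel \<psi> = distr M borel (\<lambda>x. \<psi> (S x))"
    by (simp add: distr_distr comp_def)
  then have "?\<pi> \<in> couplings (distr M borel \<psi>) (distr N borel \<psi>)"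
    unfolding push couplings_def
    by (auto simp: distr_distr comp_def cong: sets_pair_measure_cong distr_cong)
  then have "(INF \<pi>\<in>couplings (distr M borel \<psi>) (distr N borel \<psi>). \<integral>\<^sup>+ (x, y). ennreal (norm (x - y) powr 2) \<partial>\<pi>)
      \<le> (\<integral>\<^sup>+ (x, y). ennreal (norm (x - y) powr 2) \<partial>?\<pi>)"
    by (rule INF_lower)
  also have "\<dots> = (\<integral>\<^sup>+x. ennreal ((norm (\<psi> x - \<psi> (S x)))\<^sup>2) \<partial>M)"
    by (subst nn_integral_distr) auto
  finally show ?thesis
    unfolding psi_wasserstein_def wasserstein_def by (intro ennreal_powr_mono) simp_all
qed

theorem theorem8p3:
  fixes k :: enat
    and E :: "'e topology"
    and A :: "('e set \<times> ('e \<Rightarrow> real ^ 'm)) set"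
    and \<psi> :: "'e \<Rightarrow> real ^ 'n"
    and \<mu> :: "'e measure"
  assumes "1 \<le> k"
    and "Ck_manifold k E A"
    and "Ck_diffeomorphism k E A euclidean standard_atlas \<psi>"
    and "prob_space \<mu>" "sets \<mu> = sets (borel_of E)"
    and "distr \<mu> borel \<psi> = standard_gaussian"
  shows "\<forall>\<nu>. prob_space \<nu> \<and> sets \<nu> = sets (borel_of E) \<and> absolutely_continuous \<mu> \<nu> \<longrightarrow>
           psi_wasserstein 2 \<psi> \<nu> \<mu> \<le> ennreal_powr (2 * relative_entropy \<nu> \<mu>) (1 / 2)"
proof (intro allI impI, elim conjE)
  fix \<nu> :: "'e measure"
  assume "prob_space \<nu>" and sets_\<nu>: "sets \<nu> = sets (borel_of E)" and ac: "absolutely_continuous \<mu> \<nu>"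
  interpret \<mu>: prob_space \<mu> by fact
  interpret \<nu>: prob_space \<nu> by fact
  have sets_eq: "sets \<nu> = sets \<mu>" using sets_\<nu> assms(5) by simp
  let ?\<psi>' = "inv_into (topspace E) \<psi>"
  have bij: "bij_betw \<psi> (topspace E) UNIV" and "continuous_map E euclidean \<psi>"
    and "continuous_map euclidean E ?\<psi>'"
    using assms(3) by (auto simp: Ck_diffeomorphism_def Ck_map_def)
  then have \<psi>[measurable]: "\<psi> \<in> borel_measurable \<mu>" and \<psi>'[measurable]: "?\<psi>' \<in> measurable borel \<mu>"
    using measurable_continuous_map_borel_of measurable_borel_of_continuous_map assms(5)
    by (simp_all cong: measurable_cong_sets)
  have space_\<mu>: "space \<mu> = topspace E"
    using sets_eq_imp_space_eq[OF assms(5)] by (simp add: space_borel_of)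
  have inv: "\<psi> (?\<psi>' y) = y" for y
    using bij by (simp add: bij_betw_inv_into_right)
  have "distr standard_gaussian \<mu> ?\<psi>' = distr \<mu> \<mu> (?\<psi>' \<circ> \<psi>)"
    unfolding assms(6)[symmetric] by (simp add: distr_distr)
  also have "\<dots> = distr \<mu> \<mu> (\<lambda>x. x)"
    using bij by (intro distr_cong) (auto simp: space_\<mu> bij_betw_inv_into_left)
  finally have \<mu>_eq: "distr standard_gaussian \<mu> ?\<psi>' = \<mu>"
    by (simp add: distr_id[unfolded id_def])
  \<comment> \<open>The Gaussian inequality is carried along the inverse of \<psi>, so it is \<psi>
    itself that appears in the cost.\<close>
  have ineq: "map_transport_ineq \<mu> (\<lambda>x y. ennreal ((norm (\<psi> x - \<psi> y))\<^sup>2))"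
    using map_transport_ineq_distr[OF map_transport_ineq_standard_gaussian, of ?\<psi>' \<mu> \<psi>] inv \<mu>_eq
    by (simp add: standard_gaussian_def)
  show "psi_wasserstein 2 \<psi> \<nu> \<mu> \<le> ennreal_powr (2 * relative_entropy \<nu> \<mu>) (1 / 2)"
  \<comment> \<open>Without integrability the right side is \<open>\<top>\<close>.\<close>
  proof (cases "integrable \<nu> (entropy_density (exp 1) \<mu> \<nu>)")
    case False
    then show ?thesis
      by (simp add: relative_entropy_def ennreal_powr_def ennreal_mult_top)
  next
    case True
    obtain f where f[measurable]: "f \<in> borel_measurable \<mu>"
      and RN: "AE x in \<mu>. RN_deriv \<mu> \<nu> x = ennreal (f x)" and nonneg: "\<And>x. 0 \<le> f x"
      using \<mu>.real_RN_deriv[OF \<nu>.finite_measure_axioms ac sets_eq] by metis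
    have \<nu>_eq: "density \<mu> f = \<nu>"
      using RN by (subst \<mu>.density_RN_deriv[OF ac sets_eq, symmetric], intro density_cong)
        (auto elim: eventually_mono)
    have "emeasure (density \<mu> f) (space \<mu>) = 1"
      using \<nu>.emeasure_space_1 sets_eq_imp_space_eq[OF sets_eq] by (simp add: \<nu>_eq)
    then have nn_mass: "(\<integral>\<^sup>+x. ennreal (f x) \<partial>\<mu>) = 1"
      by (subst (asm) emeasure_density) (auto cong: nn_integral_cong)
    then have int: "integrable \<mu> f"
      using nonneg by (intro integrableI_nonneg) auto
    have mass: "(\<integral>x. f x \<partial>\<mu>) = 1"
      using nn_mass nonneg by (subst integral_eq_nn_integral) auto
    have density_eq: "AE x in \<nu>. entropy_density (exp 1) \<mu> \<nu> x = ln (f x)"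
    proof (rule absolutely_continuous_AE[OF sets_eq ac])
      show "AE x in \<mu>. entropy_density (exp 1) \<mu> \<nu> x = ln (f x)"
        using RN by eventually_elim (simp add: entropy_density_def nonneg log_def)
    qed
    have [measurable]: "entropy_density (exp 1) \<mu> \<nu> \<in> borel_measurable \<nu>"
      using measurable_entropy_density[of "exp 1" \<mu> \<nu>] sets_eq by (simp cong: measurable_cong_sets)
    have [measurable]: "f \<in> borel_measurable \<nu>"
      using f sets_eq by (simp cong: measurable_cong_sets)
    have "integrable \<nu> (\<lambda>x. ln (f x))"
      using True density_eq by (subst integrable_cong_AE[OF _ _ density_eq, symmetric]) auto
    then have "integrable (density \<mu> f) (\<lambda>x. ln (f x))" by (simp add: \<nu>_eq)
    then have ent: "integrable \<mu> (\<lambda>x. f x * ln (f x))"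
      using nonneg by (subst (asm) integrable_density) auto
    have "KL_divergence (exp 1) \<mu> \<nu> = (\<integral>x. ln (f x) \<partial>\<nu>)"
      unfolding KL_divergence_def by (rule integral_cong_AE[OF _ _ density_eq]) auto
    also have "\<dots> = (\<integral>x. ln (f x) \<partial>density \<mu> f)" by (simp add: \<nu>_eq)
    also have "\<dots> = (\<integral>x. f x * ln (f x) \<partial>\<mu>)"
      using nonneg by (subst integral_density) auto
    finally have KL: "KL_divergence (exp 1) \<mu> \<nu> = (\<integral>x. f x * ln (f x) \<partial>\<mu>)" .
    have rel: "2 * relative_entropy \<nu> \<mu> = ennreal (2 * (\<integral>x. f x * ln (f x) \<partial>\<mu>))"
      using True ac by (simp add: relative_entropy_def KL ennreal_mult')
    obtain S where S[measurable]: "S \<in> measurable \<mu> \<mu>" and push: "distr (density \<mu> f) \<mu> S = \<mu>"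
      and cost: "(\<integral>\<^sup>+x. ennreal (f x) * ennreal ((norm (\<psi> x - \<psi> (S x)))\<^sup>2) \<partial>\<mu>)
        \<le> ennreal (2 * (\<integral>x. f x * ln (f x) \<partial>\<mu>))"
      using map_transport_ineqD[OF ineq int nonneg mass ent] by blast
    \<comment> \<open>\<open>S\<close> carries \<nu> to \<mu>, so the cost is integrated against
      \<nu>, that is, with weight \<open>f\<close> against \<mu>.\<close>
    have "psi_wasserstein 2 \<psi> \<nu> \<mu> \<le> ennreal_powr (\<integral>\<^sup>+x. ennreal ((norm (\<psi> x - \<psi> (S x)))\<^sup>2) \<partial>\<nu>) (1 / 2)"
      using \<psi> S push sets_eq by (intro psi_wasserstein_le_map) (simp_all add: \<nu>_eq cong: measurable_cong_sets)
    also have "(\<integral>\<^sup>+x. ennreal ((norm (\<psi> x - \<psi> (S x)))\<^sup>2) \<partial>\<nu>) =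
        (\<integral>\<^sup>+x. ennreal (f x) * ennreal ((norm (\<psi> x - \<psi> (S x)))\<^sup>2) \<partial>\<mu>)"
      unfolding \<nu>_eq[symmetric] by (rule nn_integral_density) auto
    also have "ennreal_powr \<dots> (1 / 2) \<le> ennreal_powr (2 * relative_entropy \<nu> \<mu>) (1 / 2)"
      unfolding rel by (rule ennreal_powr_mono[OF _ cost]) simp
    finally show ?thesis .
  qed
qed

end
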